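(* Let $A\in S_+(\mathbb{R}^n)$ and let $\hat A$ be a random matrix with $\hat A\in S_+(\mathbb{R}^n)$ almost surely, $\mathbb{E}[\hat A]\preceq A$ (in particular this covers $\mathbb{E}[\hat A]=A$), and $\mathbb{E}[\hat A^{-2}]$ finite. Suppose that for some real $\alpha\ge1$, $0\prec\hat A\prec\alpha A$ almost surely. Let $R\in\mathbb{R}^{n\times n}$ be a nonzero symmetric positive semi-definite matrix, and let $\beta^*=\operatorname{arg\,min}_{\beta\in\mathbb{R}}\mathcal{E}_{A,R}(\hat A^{-1}-\beta\hat K)$ with $\hat K=\hat A^{-1}$. Put $$\hat Z_\alpha=\hat A-\alpha A,\qquad \hat X_\alpha=\alpha^{-1}\left(-A^{-1/2}\hat Z_\alpha A^{-1/2}\right)=I-\alpha^{-1}A^{-1/2}\hat AA^{-1/2},\qquad S=A^{-1/2}RA^{-1/2},\qquad \eta=1-\alpha^{-1},$$ and for integers $N\ge1$ define $$\beta_N=\frac{\sum_{k=0}^{N}\omega^N_\alpha(k)\,\langle\hat X_\alpha^k\rangle_S}{\sum_{k=0}^{N}\omega^N_{\alpha,*}(k)\,\langle\hat X_\alpha^k\rangle_S}=\frac{\mathbb{E}\left[\sum_{k=0}^{N}\omega^N_\alpha(k)\,\alpha^{-k}(-1)^k\,\hat q^TA^{-1}(\hat Z_\alpha A^{-1})^k\hat q\right]}{\mathbb{E}\left[\sum_{k=0}^{N}\omega^N_{\alpha,*}(k)\,\alpha^{-k}(-1)^k\,\hat q^TA^{-1}(\hat Z_\alpha A^{-1})^k\hat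 q\right]},$$ where $\hat q$ is a random vector independent of $\hat A$ with $\mathbb{E}[\hat q\hat q^T]=R$, and $$\omega^N_\alpha(k)=\begin{cases}(k+1)-\sum_{j=k}^N\eta^{j-k} & k\le N\\ 0&\text{otherwise}\end{cases},\qquad \omega^N_{\alpha,*}(k)=\begin{cases}k+1 & k\le N\\ 0&\text{otherwise}\end{cases}$$ (with $\eta^0=1$). Then $\beta_N\nearrow\beta^*$ as $N\to\infty$, $$0\le\beta_1\le\beta_2\le\cdots\le\beta_N\le\cdots\le\beta^*\le1,$$ and $$\mathcal{E}_{A,R}(\hat A^{-1})\ge\mathcal{E}_{A,R}((1-\beta_1)\hat A^{-1})\ge\cdots\ge\mathcal{E}_{A,R}((1-\beta_N)\hat A^{-1})\ge\cdots\ge\mathcal{E}_{A,R}((1-\beta^* )\hat A^{-1}).$$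
   Context: $S_+(\mathbb{R}^n)$ is the set of symmetric positive definite $n\times n$ real matrices; $\preceq,\prec$ denote the Loewner order. For symmetric positive semi-definite $P,Q$ and $X\in\mathbb{R}^{n\times n}$, $\|X\|_{P,Q}^2=\operatorname{tr}(Q^{1/2}X^TPXQ^{1/2})$, and for a random matrix $\hat Y$ regarded as an estimator of $A^{-1}$, $\mathcal{E}_{P,Q}(\hat Y)=\mathbb{E}\|\hat Y-A^{-1}\|_{P,Q}^2$. For a symmetric positive semi-definite matrix $S$ and a random matrix $\hat Y$, $\langle\hat Y\rangle_S=\mathbb{E}\operatorname{tr}(S^{1/2}\hat YS^{1/2})$. The notation $\beta_N\nearrow\beta^*$ means monotone (non-decreasing) convergence. *)

theory Defs
  imports "HOL-Probability.Probability"
begin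

(* The order and the multiplication that the library puts on the type real^'n^'n are
   componentwise, so the Loewner order and the matrix powers are introduced here under
   their own names. *)

definition pos_semidef :: "real^'n^'n \<Rightarrow> bool" where
  "pos_semidef P \<longleftrightarrow> transpose P = P \<and> (\<forall>x. 0 \<le> x \<bullet> (P *v x))"

definition pos_def :: "real^'n^'n \<Rightarrow> bool" where
  "pos_def P \<longleftrightarrow> transpose P = P \<and> (\<forall>x. x \<noteq> 0 \<longrightarrow> 0 < x \<bullet> (P *v x))"

definition loewner_le :: "real^'n^'n \<Rightarrow> real^'n^'n \<Rightarrow> bool" (infix "\<preceq>\<^sub>L" 50) where
  "P \<preceq>\<^sub>L Q \<longleftrightarrow> pos_semidef (Q - P)"

definition loewner_less :: "real^'n^'n \<Rightarrow> real^'n^'n \<Rightarrow> bool" (infix "\<prec>\<^sub>L" 50) where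
  "P \<prec>\<^sub>L Q \<longleftrightarrow> pos_def (Q - P)"

definition mat_sqrt :: "real^'n^'n \<Rightarrow> real^'n^'n" where
  "mat_sqrt P = (THE B. pos_semidef B \<and> B ** B = P)"

primrec mat_pow :: "real^'n^'n \<Rightarrow> nat \<Rightarrow> real^'n^'n" where
  "mat_pow X 0 = mat 1"
| "mat_pow X (Suc k) = X ** mat_pow X k"

definition weighted_norm_sq :: "real^'n^'n \<Rightarrow> real^'n^'n \<Rightarrow> real^'n^'n \<Rightarrow> real" where
  "weighted_norm_sq P Q X = trace (mat_sqrt Q ** transpose X ** P ** X ** mat_sqrt Q)"

(* Mean squared error of Y, regarded as an estimator of the inverse of A. *)
definition est_error ::
  "'w measure \<Rightarrow> real^'n^'n \<Rightarrow> real^'n^'n \<Rightarrow> real^'n^'n \<Rightarrow> ('w \<Rightarrow> real^'n^'n) \<Rightarrow> real" where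
  "est_error M A P Q Y = (\<integral>\<omega>. weighted_norm_sq P Q (Y \<omega> - matrix_inv A) \<partial>M)"

definition trace_mean :: "'w measure \<Rightarrow> real^'n^'n \<Rightarrow> ('w \<Rightarrow> real^'n^'n) \<Rightarrow> real" where
  "trace_mean M S Y = (\<integral>\<omega>. trace (mat_sqrt S ** Y \<omega> ** mat_sqrt S) \<partial>M)"

definition weight :: "real \<Rightarrow> nat \<Rightarrow> nat \<Rightarrow> real" where
  "weight \<alpha> N k =
     (if k \<le> N then real (k + 1) - (\<Sum>j=k..N. (1 - inverse \<alpha>) ^ (j - k)) else 0)"

definition weight_star :: "nat \<Rightarrow> nat \<Rightarrow> real" where
  "weight_star N k = (if k \<le> N then real (k + 1) else 0)"

definition outer_product :: "real^'n \<Rightarrow> real^'n^'n" where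
  "outer_product q = (\<chi> i j. q $ i * q $ j)"

(* The library's indep_var needs both variables to take values in the same type; this is
   the same condition (independence of the generated sigma-algebras) for two types. *)
definition indep_rv ::
  "'w measure \<Rightarrow> ('w \<Rightarrow> 'a::topological_space) \<Rightarrow> ('w \<Rightarrow> 'b::topological_space) \<Rightarrow> bool" where
  "indep_rv M X Y \<longleftrightarrow>
     prob_space.indep_set M (sets (vimage_algebra (space M) X borel))
                            (sets (vimage_algebra (space M) Y borel))"

end

theory Submission
  imports Defs
begin

text \<open>
  Write \<open>x k\<close> for the moment \<open>E tr (S X^k)\<close>. In an eigenbasis of \<open>X\<close>, whose eigenvalues lie in \<open>(0, 1)\<close>,
  \<open>tr (S X^k)\<close> is a positive combination of \<open>k\<close>-th powers of the eigenvalues. So \<open>x\<close> is positive and log-convex,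
  and since \<open>\<alpha> (1 - X)\<close> is \<open>Ahat\<close> conjugated by the inverse square root of \<open>A\<close>, the geometric series give
  \<open>E tr (R K) = (1/\<alpha>) \<Sum>k. x k\<close> and \<open>E tr (R K A K) = (1/\<alpha>^2) \<Sum>k. (k + 1) x k\<close>. The risk is a quadratic polynomial
  in \<open>1 - \<beta>\<close> with minimizer \<open>E tr (R K) / E tr (R K A K)\<close>.

  On the other hand \<open>1 - \<beta> N\<close> is the quotient of the partial sums of \<open>c j = \<Sum>k\<le>j. \<eta>^(j-k) x k\<close> (a Cauchy
  product with a geometric series of sum \<open>\<alpha>\<close>) and \<open>d j = (j + 1) x j\<close>, which gives the limit. For monotonicity
  it suffices that \<open>c j / d j\<close> decreases. The ratios \<open>q j = \<eta> x j / x (j + 1)\<close> decrease by log-convexity and start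
  with \<open>q 0 \<le> 1\<close>, which is the hypothesis on the mean of \<open>Ahat\<close>; hence \<open>c j / x j\<close> is at least the geometric sum
  \<open>\<Sum>i\<le>j. q j ^ i\<close>, and this is enough for \<open>c (j + 1) / d (j + 1) \<le> c j / d j\<close>.
\<close>

section \<open>Symmetric matrices\<close>

text \<open>In finite dimension bilinearity already forces boundedness. The interpretation below
  then supplies linearity rules, continuity and a norm bound for \<open>**\<close>, which carry both
  the algebra and the integrability arguments.\<close>

lemma bounded_bilinear_matrix_mult:
  "bounded_bilinear ((**) :: real^'n^'m \<Rightarrow> real^'p^'n \<Rightarrow> real^'p^'m)"
proof -
  have "bilinear ((**) :: real^'n^'m \<Rightarrow> real^'p^'n \<Rightarrow> real^'p^'m)"
    unfolding bilinear_def
    by (intro conjI allI linearI)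
       (simp_all add: vec_eq_iff matrix_matrix_mult_def sum.distrib sum_distrib_left algebra_simps)
  then show ?thesis
    by (simp add: bilinear_conv_bounded_bilinear)
qed

interpretation matrix_mult: bounded_bilinear
  "(**) :: real^'n^'m \<Rightarrow> real^'p^'n \<Rightarrow> real^'p^'m"
  by (rule bounded_bilinear_matrix_mult)

lemma bounded_linear_trace: "bounded_linear (trace :: real^'n^'n \<Rightarrow> real)"
proof -
  have "linear (trace :: real^'n^'n \<Rightarrow> real)"
    by (intro linearI) (simp_all add: trace_def sum.distrib sum_distrib_left)
  then show ?thesis
    by (simp add: linear_conv_bounded_linear)
qed

lemma trace_scaleR: "trace (c *\<^sub>R P) = c * trace (P :: real^'n^'n)"
  by (simp add: trace_def sum_distrib_left)

lemma transpose_diff: "transpose (P - Q) = transpose P - transpose (Q :: real^'n^'m)"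
proof -
  have "transpose (P - Q) $ i $ j = (transpose P - transpose Q) $ i $ j" for i j
    by (simp add: transpose_def)
  then show ?thesis unfolding vec_eq_iff by blast
qed

lemma inner_matrix_vector_symmetric:
  fixes P :: "real^'n^'n"
  assumes "transpose P = P"
  shows "(P *v x) \<bullet> y = x \<bullet> (P *v y)"
  using dot_lmul_matrix[of x P y] transpose_matrix_vector[of P x] by (simp add: assms)

text \<open>Encoded as a set, so that eigenvalues and weights become functions of the basis vector
  itself and no indexing by \<open>'n\<close> enters.\<close>

definition orthonormal_basis :: "(real^'n) set \<Rightarrow> bool" where
  "orthonormal_basis E \<longleftrightarrow>
     finite E \<and> pairwise orthogonal E \<and> (\<forall>e\<in>E. norm e = 1) \<and> span E = UNIV"

lemma orthonormal_basis_sum: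
  assumes "orthonormal_basis E"
  shows "(\<Sum>e\<in>E. (x \<bullet> e) *\<^sub>R e) = x"
  using assms unfolding orthonormal_basis_def by (intro orthonormal_basis_expand) auto

lemma orthonormal_basis_inner:
  assumes "orthonormal_basis E"
  shows "(\<Sum>e\<in>E. (x \<bullet> e) * (y \<bullet> e)) = x \<bullet> y"
proof -
  have "x \<bullet> y = (\<Sum>e\<in>E. (x \<bullet> e) *\<^sub>R e) \<bullet> y"
    by (simp only: orthonormal_basis_sum[OF assms])
  also have "\<dots> = (\<Sum>e\<in>E. (x \<bullet> e) * (y \<bullet> e))"
    unfolding inner_sum_left by (simp add: inner_commute)
  finally show ?thesis by simp
qed

lemma matrix_eq_on_orthonormal_basis:
  fixes P Q :: "real^'n^'n"
  assumes E: "orthonormal_basis E" and "\<And>e. e \<in> E \<Longrightarrow> P *v e = Q *v e"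
  shows "P = Q"
proof -
  have "P *v x = Q *v x" for x
  proof -
    have "P *v (\<Sum>e\<in>E. (x \<bullet> e) *\<^sub>R e) = Q *v (\<Sum>e\<in>E. (x \<bullet> e) *\<^sub>R e)"
      unfolding linear_sum[OF matrix_vector_mul_linear]
      by (intro sum.cong) (simp_all add: matrix_vector_mult_scaleR assms(2))
    then show ?thesis
      by (simp only: orthonormal_basis_sum[OF E])
  qed
  then show ?thesis
    by (simp add: matrix_eq)
qed

lemma inner_axis_matrix: "axis i 1 \<bullet> (P *v axis j 1) = (P :: real^'n^'n) $ i $ j"
  by (simp add: inner_axis' inner_axis matrix_vector_mul_component)

text \<open>Expand in coordinates and swap the sums: the inner sum over \<open>E\<close> is then
  Parseval's identity for \<open>transpose P *v axis i 1\<close> and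
  \<open>axis i 1\<close>.\<close>

lemma trace_orthonormal_basis:
  fixes P :: "real^'n^'n"
  assumes E: "orthonormal_basis E"
  shows "trace P = (\<Sum>e\<in>E. e \<bullet> (P *v e))"
proof -
  have "(\<Sum>e\<in>E. e \<bullet> (P *v e)) = (\<Sum>e\<in>E. \<Sum>i\<in>UNIV. (transpose P *v axis i 1) \<bullet> e * (axis i 1 \<bullet> e))"
  proof (rule sum.cong[OF refl])
    fix e
    have "e \<bullet> (P *v e) = (\<Sum>i\<in>UNIV. e $ i * (P *v e) $ i)"
      by (simp add: inner_vec_def)
    also have "\<dots> = (\<Sum>i\<in>UNIV. (transpose P *v axis i 1) \<bullet> e * (axis i 1 \<bullet> e))"
      by (intro sum.cong) (simp_all add: dot_lmul_matrix inner_axis')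
    finally show "e \<bullet> (P *v e) = (\<Sum>i\<in>UNIV. (transpose P *v axis i 1) \<bullet> e * (axis i 1 \<bullet> e))" .
  qed
  also have "\<dots> = (\<Sum>i\<in>UNIV. (transpose P *v axis i 1) \<bullet> axis i 1)"
    by (subst sum.swap) (simp add: orthonormal_basis_inner[OF E] del: transpose_matrix_vector)
  also have "\<dots> = trace P"
    by (simp add: dot_lmul_matrix inner_axis_matrix trace_def)
  finally show ?thesis by simp
qed

text \<open>By compactness the quadratic form attains its maximum on the unit sphere of
  \<open>V\<close>. The first variation at a maximizer \<open>v\<close> vanishes in every direction
  of \<open>V\<close> orthogonal to \<open>v\<close>; invariance of \<open>V\<close> makes
  \<open>P *v v - l *\<^sub>R v\<close> such a direction, so it is zero.\<close>

lemma Rayleigh_maximum_eigenvector: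
  fixes P :: "real^'n^'n"
  assumes P: "transpose P = P" and V: "subspace V" "\<And>x. x \<in> V \<Longrightarrow> P *v x \<in> V"
    and "V \<noteq> {0}"
  obtains v l where "v \<in> V" "norm v = 1" "P *v v = l *\<^sub>R v"
proof -
  let ?f = "\<lambda>x. x \<bullet> (P *v x)"
  let ?K = "V \<inter> sphere 0 1"
  obtain w where w: "w \<in> V" "w \<noteq> 0"
    using \<open>V \<noteq> {0}\<close> subspace_0[OF V(1)] by blast
  have "w /\<^sub>R norm w \<in> ?K"
    using w V(1) by (simp add: subspace_scale)
  then have "?K \<noteq> {}" by blast
  moreover have "compact ?K"
    by (intro closed_Int_compact closed_subspace V compact_sphere)
  moreover have "continuous_on ?K ?f"
    by (intro continuous_intros)
  ultimately obtain v where v: "v \<in> ?K" and max: "\<And>x. x \<in> ?K \<Longrightarrow> ?f x \<le> ?f v"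
    using continuous_attains_sup[of ?K ?f] by blast
  define l where "l = ?f v"
  have vV: "v \<in> V" "norm v = 1" and vv: "v \<bullet> v = 1"
    using v by (auto simp: dot_square_norm)
  have bound: "?f x \<le> l * (x \<bullet> x)" if "x \<in> V" for x
  proof (cases "x = 0")
    case False
    have "x /\<^sub>R norm x \<in> ?K"
      using that False V(1) by (simp add: subspace_scale)
    then have "?f (x /\<^sub>R norm x) \<le> l"
      unfolding l_def by (rule max)
    moreover have "?f (x /\<^sub>R norm x) = ?f x / (x \<bullet> x)"
      by (simp add: matrix_vector_mult_scaleR dot_square_norm power2_eq_square field_simps)
    ultimately show ?thesis
      using False by (simp add: divide_le_eq)
  qed simp
  have orth: "w \<bullet> (P *v v) = 0" if w: "w \<in> V" "w \<bullet> v = 0" for w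
  proof (rule ccontr)
    assume nz: "w \<bullet> (P *v v) \<noteq> 0"
    define b c where "b = w \<bullet> (P *v v)" and "c = l * (w \<bullet> w) - ?f w"
    have quad: "2 * t * b \<le> t^2 * c" for t
    proof -
      have "?f (v + t *\<^sub>R w) \<le> l * ((v + t *\<^sub>R w) \<bullet> (v + t *\<^sub>R w))"
        by (intro bound subspace_add V subspace_scale vV w)
      moreover have "v \<bullet> (P *v w) = b"
        using inner_matrix_vector_symmetric[OF P, of v w] by (simp add: b_def inner_commute)
      ultimately show ?thesis
        using w(2) vv
        by (simp add: matrix_vector_right_distrib matrix_vector_mult_scaleR inner_add
            inner_commute[of v w] b_def[symmetric] l_def[symmetric] c_def algebra_simps power2_eq_square)
    qed
    \<comment> \<open>A step short enough for the linear term of \<open>quad\<close> to beat the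
      quadratic one. The denominator exceeds \<open>c\<close> and stays positive when
      \<open>c\<close> is zero.\<close>
    define s where "s = b / (\<bar>c\<bar> + 1)"
    have "2 * s * b \<le> s^2 * c" by (rule quad)
    also have "\<dots> \<le> s^2 * (\<bar>c\<bar> + 1)" by (intro mult_left_mono) auto
    also have "\<dots> = s * b"
      by (simp add: s_def power2_eq_square)
    finally have "s * b \<le> 0" by (simp add: mult.commute)
    moreover have "s * b = b^2 / (\<bar>c\<bar> + 1)" by (simp add: s_def power2_eq_square)
    moreover have "b^2 / (\<bar>c\<bar> + 1) > 0" using nz by (simp add: b_def)
    ultimately show False by linarith
  qed
  define u where "u = P *v v - l *\<^sub>R v"
  have u: "u \<in> V" "u \<bullet> v = 0"
    using vV V vv
    by (auto simp: u_def l_def subspace_diff subspace_scale inner_diff_left inner_diff_right inner_commute)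
  have "u \<bullet> u = u \<bullet> (P *v v)"
    using u(2) by (simp add: u_def inner_diff_right)
  then have "u = 0"
    using orth[OF u] by simp
  then show thesis
    using that[of v l] vV by (simp add: u_def)
qed

text \<open>Induction on the dimension, generalized to invariant subspaces \<open>V\<close>: an
  eigenvector is split off, and by symmetry its orthogonal complement inside \<open>V\<close> is
  again invariant.\<close>

theorem symmetric_eigenbasis:
  fixes P :: "real^'n^'n"
  assumes P: "transpose P = P"
  shows "\<exists>E l. orthonormal_basis E \<and> (\<forall>e\<in>E. P *v e = l e *\<^sub>R e)"
proof -
  have "\<exists>E. finite E \<and> pairwise orthogonal E \<and> (\<forall>e\<in>E. norm e = 1 \<and> (\<exists>c. P *v e = c *\<^sub>R e)) \<and> span E = V"
    if "subspace V" "\<forall>x\<in>V. P *v x \<in> V" for V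
    using that
  proof (induction "dim V" arbitrary: V rule: less_induct)
    case less
    show ?case
    proof (cases "V = {0}")
      case True
      then show ?thesis by (intro exI[of _ "{}"]) simp
    next
      case False
      obtain v c where v: "v \<in> V" "norm v = 1" "P *v v = c *\<^sub>R v"
        using Rayleigh_maximum_eigenvector[OF P less.prems(1) _ False] less.prems(2) by blast
      have vv: "v \<bullet> v = 1" using v(2) by (simp add: dot_square_norm)
      define W where "W = V \<inter> {x. v \<bullet> x = 0}"
      have W: "subspace W"
        unfolding W_def by (intro subspace_inter less.prems subspace_hyperplane)
      have inv: "\<forall>x\<in>W. P *v x \<in> W"
        using less.prems(2) inner_matrix_vector_symmetric[OF P, of v] v(3)
        by (auto simp: W_def) (metis inner_scaleR_left mult_zero_right)
      have "W \<subseteq> V" "v \<notin> W" using vv by (auto simp: W_def)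
      then have "W \<subset> V" using v(1) by blast
      then have "dim W < dim V"
        by (metis W dim_psubset less.prems(1) span_eq_iff)
      from less.hyps[OF this W inv] obtain F where F: "finite F" "pairwise orthogonal F"
        "\<forall>e\<in>F. norm e = 1 \<and> (\<exists>c. P *v e = c *\<^sub>R e)" "span F = W" by blast
      have orth: "v \<bullet> e = 0" if "e \<in> F" for e
        using that span_base[of e F] F(4) by (auto simp: W_def)
      have "span (insert v F) = V"
      proof
        show "span (insert v F) \<subseteq> V"
          using v(1) F(4) \<open>W \<subseteq> V\<close> span_superset[of F] by (intro span_minimal less.prems) auto
        show "V \<subseteq> span (insert v F)"
        proof
          fix x assume "x \<in> V"
          then have "x - (v \<bullet> x) *\<^sub>R v \<in> W"
            using vv v(1) less.prems(1) by (auto simp: W_def inner_diff_right subspace_diff subspace_scale)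
          then show "x \<in> span (insert v F)"
            using F(4) span_insert by blast
        qed
      qed
      moreover have "pairwise orthogonal (insert v F)"
        using F(2) orth by (auto simp: pairwise_insert orthogonal_def inner_commute)
      ultimately show ?thesis
        using F v by (intro exI[of _ "insert v F"]) blast
    qed
  qed
  from this[of UNIV] obtain E where E: "orthonormal_basis E" "\<forall>e\<in>E. \<exists>c. P *v e = c *\<^sub>R e"
    unfolding orthonormal_basis_def by auto
  then show ?thesis by metis
qed

section \<open>Square roots and inverses\<close>

text \<open>Functional calculus: the witness is the sum of the rank-one projections onto the basis
  vectors, weighted by \<open>g\<close>. It produces square roots below.\<close>

lemma matrix_of_orthonormal_basis:
  fixes E :: "(real^'n) set"
  assumes E: "orthonormal_basis E"
  shows "\<exists>B :: real^'n^'n. transpose B = B \<and> (\<forall>e\<in>E. B *v e = g e *\<^sub>R e) \<and>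
    (\<forall>x. x \<bullet> (B *v x) = (\<Sum>e\<in>E. g e * (x \<bullet> e)^2))"
proof (intro exI conjI ballI allI)
  define B :: "real^'n^'n" where "B = (\<chi> i j. \<Sum>e\<in>E. g e * e $ i * e $ j)"
  have B: "B *v x = (\<Sum>e\<in>E. (g e * (x \<bullet> e)) *\<^sub>R e)" for x
  proof -
    have "(\<Sum>j\<in>UNIV. (\<Sum>e\<in>E. g e * e $ i * e $ j) * x $ j) = (\<Sum>e\<in>E. g e * (x \<bullet> e) * e $ i)" for i
      unfolding inner_vec_def sum_distrib_right sum_distrib_left
      by (subst sum.swap) (simp add: mult_ac)
    then show ?thesis
      by (simp add: vec_eq_iff B_def matrix_vector_mult_def)
  qed
  show "transpose B = B"
    by (simp add: B_def transpose_def vec_eq_iff mult_ac)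
  show "x \<bullet> (B *v x) = (\<Sum>e\<in>E. g e * (x \<bullet> e)^2)" for x
    by (simp add: B inner_sum_right power2_eq_square mult_ac)
  show "B *v e = g e *\<^sub>R e" if "e \<in> E" for e
  proof -
    have "(g f * (e \<bullet> f)) *\<^sub>R f = (if f = e then g e *\<^sub>R e else 0)" if "f \<in> E" for f
      using E that \<open>e \<in> E\<close>
      by (auto simp: orthonormal_basis_def pairwise_def orthogonal_def dot_square_norm)
    then have "B *v e = (\<Sum>f\<in>E. if f = e then g e *\<^sub>R e else 0)"
      unfolding B by (intro sum.cong) auto
    then show ?thesis
      using E that by (simp add: orthonormal_basis_def)
  qed
qed

text \<open>Factoring B^2 - m shows that \<open>w = B *v e - sqrt m *\<^sub>R e\<close> satisfies B
  w = -sqrt(m) w. Semidefiniteness rules this out unless \<open>w\<close> or \<open>m\<close>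
  vanishes, and for m = 0 the norm of B e is zero.\<close>

lemma pos_semidef_eigenvector_of_square:
  fixes B :: "real^'n^'n"
  assumes B: "pos_semidef B" and "B ** B *v e = m *\<^sub>R e"
  shows "B *v e = sqrt m *\<^sub>R e"
proof -
  have sym: "transpose B = B" and nonneg: "\<And>x. 0 \<le> x \<bullet> (B *v x)"
    using B by (auto simp: pos_semidef_def)
  have BB: "B *v (B *v e) = m *\<^sub>R e" using assms(2) by (simp add: matrix_vector_mul_assoc)
  show ?thesis
  proof (cases "e = 0")
    case False
    have "(B *v e) \<bullet> (B *v e) = m * (e \<bullet> e)"
      using inner_matrix_vector_symmetric[OF sym, of e "B *v e"] by (simp add: BB)
    then have "m * (e \<bullet> e) \<ge> 0" by (metis inner_ge_zero)
    moreover have "e \<bullet> e > 0" using False by simp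
    ultimately have m: "m \<ge> 0" by (simp add: zero_le_mult_iff)
    define w where "w = B *v e - sqrt m *\<^sub>R e"
    have Bw: "B *v w = - sqrt m *\<^sub>R w"
      using m by (simp add: w_def matrix_vector_mult_diff_distrib matrix_vector_mult_scaleR BB
          scaleR_diff_right)
    have "0 \<le> w \<bullet> (B *v w)" by (rule nonneg)
    then have "sqrt m * (w \<bullet> w) \<le> 0" by (simp add: Bw)
    then have "m = 0 \<or> w \<bullet> w \<le> 0"
      using m by (auto simp: mult_le_0_iff)
    then have "m = 0 \<or> w = 0"
      by (metis inner_eq_zero_iff inner_ge_zero order_antisym)
    then consider "m = 0" | "w = 0" by blast
    then show ?thesis
    proof cases
      case 1
      then have "(B *v e) \<bullet> (B *v e) = 0"
        using \<open>(B *v e) \<bullet> (B *v e) = m * (e \<bullet> e)\<close> by simp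
      then show ?thesis using 1 by simp
    next
      case 2
      then show ?thesis by (simp add: w_def)
    qed
  qed simp
qed

text \<open>Existence takes roots of the eigenvalues. For uniqueness, any semidefinite root of
  \<open>P\<close> is determined on the eigenbasis of \<open>P\<close> by the preceding lemma.
  Together they make the \<open>THE\<close> in \<open>mat_sqrt\<close> meaningful.\<close>

lemma pos_semidef_mat_sqrt:
  fixes P :: "real^'n^'n"
  assumes P: "pos_semidef P"
  shows "pos_semidef (mat_sqrt P)" "mat_sqrt P ** mat_sqrt P = P"
proof -
  have sym: "transpose P = P" and nonneg: "\<And>x. 0 \<le> x \<bullet> (P *v x)"
    using P by (auto simp: pos_semidef_def)
  obtain E l where E: "orthonormal_basis E" and l: "\<And>e. e \<in> E \<Longrightarrow> P *v e = l e *\<^sub>R e"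
    using symmetric_eigenbasis[OF sym] by auto
  have l0: "l e \<ge> 0" if "e \<in> E" for e
    using nonneg[of e] that E l[of e] by (simp add: orthonormal_basis_def dot_square_norm)
  obtain B :: "real^'n^'n" where B: "transpose B = B" "\<And>e. e \<in> E \<Longrightarrow> B *v e = sqrt (l e) *\<^sub>R e"
    and quad: "\<And>x. x \<bullet> (B *v x) = (\<Sum>e\<in>E. sqrt (l e) * (x \<bullet> e)^2)"
    using matrix_of_orthonormal_basis[OF E, of "\<lambda>e. sqrt (l e)"] by auto
  have "B ** B = P"
  proof (rule matrix_eq_on_orthonormal_basis[OF E])
    fix e assume "e \<in> E"
    then show "B ** B *v e = P *v e"
      using l0[of e] by (simp add: matrix_vector_mul_assoc[symmetric] matrix_vector_mult_scaleR B l)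
  qed
  moreover have "pos_semidef B"
    unfolding pos_semidef_def quad using B(1) l0 by (auto intro!: sum_nonneg mult_nonneg_nonneg)
  moreover have "C = B" if C: "pos_semidef C \<and> C ** C = P" for C
  proof (rule matrix_eq_on_orthonormal_basis[OF E])
    fix e assume "e \<in> E"
    then show "C *v e = B *v e"
      using C l[of e] B(2)[of e] pos_semidef_eigenvector_of_square[of C e "l e"] by simp
  qed
  ultimately have "pos_semidef (mat_sqrt P) \<and> mat_sqrt P ** mat_sqrt P = P"
    unfolding mat_sqrt_def
    by (intro theI[where P="\<lambda>B. pos_semidef B \<and> B ** B = P" and a=B]) blast+
  then show "pos_semidef (mat_sqrt P)" "mat_sqrt P ** mat_sqrt P = P" by auto
qed

lemma trace_mat_sqrt_conj:
  fixes Y :: "real^'n^'n"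
  assumes "pos_semidef P"
  shows "trace (mat_sqrt P ** Y ** mat_sqrt P) = trace (P ** Y)"
  using trace_mul_sym[of "mat_sqrt P ** Y" "mat_sqrt P"]
  by (simp add: matrix_mul_assoc pos_semidef_mat_sqrt(2)[OF assms])

lemma matrix_inv_unique:
  fixes A :: "real^'n^'n"
  assumes "A ** B = mat 1"
  shows "matrix_inv A = B"
proof -
  have "B ** A = mat 1" using assms by (simp add: matrix_left_right_inverse)
  then have "\<exists>B. A ** B = mat 1 \<and> B ** A = mat 1" using assms by blast
  then have "matrix_inv A ** A = mat 1"
    unfolding matrix_inv_def by (rule someI2_ex) blast
  then show ?thesis
    using matrix_mul_assoc[of "matrix_inv A" A B] by (simp add: assms)
qed

lemma pos_def_imp_pos_semidef: "pos_def P \<Longrightarrow> pos_semidef P"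
  unfolding pos_def_def pos_semidef_def
proof (elim conjE, intro conjI allI)
  fix x assume "\<forall>x. x \<noteq> 0 \<longrightarrow> 0 < x \<bullet> (P *v x)"
  then show "0 \<le> x \<bullet> (P *v x)" by (cases "x = 0") (auto intro: less_imp_le)
qed

lemma matrix_inv_pos_def:
  fixes P :: "real^'n^'n"
  assumes P: "pos_def P"
  shows "P ** matrix_inv P = mat 1" "matrix_inv P ** P = mat 1"
    "transpose (matrix_inv P) = matrix_inv P"
proof -
  have "\<forall>x. P *v x = 0 \<longrightarrow> x = 0"
    using P unfolding pos_def_def by force
  then obtain B where B: "B ** P = mat 1"
    using matrix_left_invertible_ker by blast
  then have PB: "P ** B = mat 1" by (simp add: matrix_left_right_inverse)
  have inv: "matrix_inv P = B" by (rule matrix_inv_unique[OF PB])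
  show "P ** matrix_inv P = mat 1" "matrix_inv P ** P = mat 1" by (simp_all add: inv B PB)
  have "P ** transpose B = mat 1"
    using arg_cong[OF B, of transpose] P by (simp add: matrix_transpose_mul transpose_mat pos_def_def)
  then show "transpose (matrix_inv P) = matrix_inv P"
    using matrix_inv_unique[of P "transpose B"] inv by simp
qed

text \<open>With C the root of the root B, x . Bx is the squared norm of Cx. If it vanishes, then so
  do Cx, Bx and Px in turn, and x = 0.\<close>

lemma pos_def_mat_sqrt:
  fixes P :: "real^'n^'n"
  assumes P: "pos_def P"
  shows "pos_def (mat_sqrt P)"
proof -
  let ?B = "mat_sqrt P"
  have B: "pos_semidef ?B" "?B ** ?B = P"
    using pos_semidef_mat_sqrt[OF pos_def_imp_pos_semidef[OF P]] by auto
  have C: "pos_semidef (mat_sqrt ?B)" "mat_sqrt ?B ** mat_sqrt ?B = ?B"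
    using pos_semidef_mat_sqrt[OF B(1)] by auto
  have "x \<bullet> (?B *v x) \<noteq> 0" if "x \<noteq> 0" for x
  proof
    assume "x \<bullet> (?B *v x) = 0"
    then have "(mat_sqrt ?B *v x) \<bullet> (mat_sqrt ?B *v x) = 0"
      using inner_matrix_vector_symmetric[of "mat_sqrt ?B" x "mat_sqrt ?B *v x"] C
      by (simp only: matrix_vector_mul_assoc pos_semidef_def)
    then have "?B *v x = 0"
      using matrix_vector_mul_assoc[of "mat_sqrt ?B" "mat_sqrt ?B" x] by (simp add: C(2))
    then have "P *v x = 0"
      using matrix_vector_mul_assoc[of ?B ?B x] by (simp add: B(2))
    then show False using P that unfolding pos_def_def by force
  qed
  then show ?thesis
    using B(1) unfolding pos_semidef_def pos_def_def by (auto simp: order_le_less)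
qed

lemma quadratic_form_congruence:
  fixes B P :: "real^'n^'n"
  assumes "transpose B = B"
  shows "x \<bullet> ((B ** P ** B) *v x) = (B *v x) \<bullet> (P *v (B *v x))"
  using inner_matrix_vector_symmetric[OF assms, of x "P *v (B *v x)"]
  by (simp add: matrix_vector_mul_assoc matrix_mul_assoc)

lemma pos_semidef_congruence:
  fixes B P :: "real^'n^'n"
  assumes "transpose B = B" "pos_semidef P"
  shows "pos_semidef (B ** P ** B)"
  using assms unfolding pos_semidef_def quadratic_form_congruence[OF assms(1)]
  by (simp add: matrix_transpose_mul matrix_mul_assoc)

lemma pos_def_congruence:
  fixes B P :: "real^'n^'n"
  assumes "transpose B = B" "C ** B = mat 1" "pos_def P"
  shows "pos_def (B ** P ** B)"
  unfolding pos_def_def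
proof safe
  show "transpose (B ** P ** B) = B ** P ** B"
    using assms by (simp add: matrix_transpose_mul matrix_mul_assoc pos_def_def)
  fix x :: "real^'n" assume "x \<noteq> 0"
  then have "B *v x \<noteq> 0"
    using matrix_vector_mul_assoc[of C B x] by (auto simp: assms(2))
  then show "0 < x \<bullet> ((B ** P ** B) *v x)"
    using assms by (simp add: quadratic_form_congruence pos_def_def)
qed

lemma trace_pos_semidef_nonneg: "pos_semidef P \<Longrightarrow> 0 \<le> trace (P :: real^'n^'n)"
  unfolding trace_def pos_semidef_def inner_axis_matrix[symmetric] by (intro sum_nonneg) blast

lemma pos_semidef_entry_bound:
  fixes P :: "real^'n^'n"
  assumes "pos_semidef P"
  shows "\<bar>P $ i $ j\<bar> \<le> (P $ i $ i + P $ j $ j) / 2"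
proof -
  have sym: "P $ j $ i = P $ i $ j"
  proof -
    have "P $ j $ i = transpose P $ i $ j" by (simp add: transpose_def)
    then show ?thesis using assms by (simp only: pos_semidef_def)
  qed
  have "(axis i 1 + c *\<^sub>R axis j 1) \<bullet> (P *v (axis i 1 + c *\<^sub>R axis j 1)) =
      P $ i $ i + c * P $ i $ j + (c * P $ j $ i + c * c * P $ j $ j)" for c
    by (simp only: matrix_vector_right_distrib matrix_vector_mult_scaleR inner_add_left
        inner_add_right inner_scaleR_left inner_scaleR_right inner_axis_matrix) (simp add: algebra_simps)
  then have "0 \<le> P $ i $ i + c * P $ i $ j + (c * P $ j $ i + c * c * P $ j $ j)" for c
    using assms unfolding pos_semidef_def by metis
  \<comment> \<open>The test vectors e_i + e_j and e_i - e_j bound the entry from below and from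
    above.\<close>
  from this[of 1] this[of "-1"] show ?thesis by (simp add: sym)
qed

lemma pos_semidef_zero_trace:
  fixes P :: "real^'n^'n"
  assumes "pos_semidef P" "trace P = 0"
  shows "P = 0"
proof -
  have "P $ i $ i \<ge> 0" for i
    using assms(1) unfolding pos_semidef_def inner_axis_matrix[symmetric] by blast
  then have "P $ i $ i = 0" for i
    using assms(2) by (simp add: trace_def sum_nonneg_eq_0_iff)
  then have "P $ i $ j = 0" for i j
    using pos_semidef_entry_bound[OF assms(1), of i j] by simp
  then show ?thesis by (simp add: vec_eq_iff)
qed

section \<open>Log-convex sequences\<close>

text \<open>With m = j + 1 the claim reads m <= (1 + m (1 - q)) r. The coefficient of r is
  nonnegative, so r may be replaced by the geometric sum; telescoping then leaves m q^m <= sum,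
  which holds because q^m is below each of the m summands.\<close>

lemma geometric_sum_inequality:
  fixes q r :: real
  assumes q: "0 \<le> q" "q \<le> 1" and r: "(\<Sum>i\<le>j. q ^ i) \<le> r"
  shows "real (j + 1) * (q * r + 1) \<le> real (j + 2) * r"
proof -
  let ?S = "\<Sum>i\<le>j. q ^ i"
  define m p where "m = real (j + 1)" and "p = q ^ (j + 1)"
  have "(1 - q) * ?S = 1 - p"
    using one_diff_power_eq[of q "j + 1"] by (simp add: lessThan_Suc_atMost p_def)
  then have "(1 + m * (1 - q)) * ?S = ?S + m * (1 - p)"
    by (simp only: distrib_right mult.assoc mult_1_left)
  moreover have "m * p \<le> ?S"
    using sum_bounded_below[of "{..j}" p "\<lambda>i. q ^ i"] q
    by (simp add: power_decreasing m_def p_def del: power_Suc)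
  moreover have "(1 + m * (1 - q)) * ?S \<le> (1 + m * (1 - q)) * r"
    using q r by (intro mult_left_mono) (auto simp: m_def)
  ultimately have "m \<le> (1 + m * (1 - q)) * r"
    by (simp add: right_diff_distrib)
  moreover have "real (j + 1) = m" "real (j + 2) = m + 1"
    by (simp_all add: m_def)
  ultimately show ?thesis
    by (simp only:) (simp add: algebra_simps)
qed

locale log_convex_sequence =
  fixes x :: "nat \<Rightarrow> real" and \<eta> :: real
  assumes pos: "x k > 0"
    and log_convex: "x (k + 1) ^ 2 \<le> x k * x (k + 2)"
    and \<eta>: "0 \<le> \<eta>" "\<eta> < 1"
    and initial: "\<eta> * x 0 \<le> x 1"
begin

definition c :: "nat \<Rightarrow> real" where "c j = (\<Sum>k\<le>j. \<eta> ^ (j - k) * x k)"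

definition d :: "nat \<Rightarrow> real" where "d j = real (j + 1) * x j"

definition C :: "nat \<Rightarrow> real" where "C N = (\<Sum>j\<le>N. c j)"

definition D :: "nat \<Rightarrow> real" where "D N = (\<Sum>j\<le>N. d j)"

lemma c_Suc: "c (Suc j) = \<eta> * c j + x (Suc j)"
  unfolding c_def by (simp add: sum_distrib_left Suc_diff_le mult.assoc)

lemma c_pos: "c j > 0"
  using pos \<eta> by (induction j) (auto simp: c_Suc c_def[of 0] intro: add_nonneg_pos)

lemma d_pos: "d j > 0"
  using pos by (simp add: d_def)

lemma D_pos: "D N > 0"
  unfolding D_def by (auto intro!: sum_pos d_pos)

definition q :: "nat \<Rightarrow> real" where "q j = \<eta> * x j / x (Suc j)"

lemma q_nonneg: "0 \<le> q j"
  using pos \<eta> by (simp add: q_def less_imp_le)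

lemma q_Suc_le: "q (Suc j) \<le> q j"
proof -
  have "x (Suc j) / x (Suc (Suc j)) \<le> x j / x (Suc j)"
    using log_convex[of j] pos by (simp add: divide_simps power2_eq_square)
  then show ?thesis
    using mult_left_mono[OF _ \<eta>(1), of "x (Suc j) / x (Suc (Suc j))" "x j / x (Suc j)"] by (simp add: q_def)
qed

lemma q_le_1: "q j \<le> 1"
proof (induction j)
  case 0
  then show ?case using initial pos[of 1] by (simp add: q_def)
next
  case (Suc j)
  then show ?case using q_Suc_le[of j] by linarith
qed

text \<open>The recursion for r = \<open>c j / x j\<close>, in the form q r + 1 that
  \<open>geometric_sum_inequality\<close> treats.\<close>

lemma c_ratio_Suc: "c (Suc j) / x (Suc j) = q j * (c j / x j) + 1"
  using pos[of j] pos[of "Suc j"] by (simp add: c_Suc q_def divide_simps)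

text \<open>Unfolding the recursion, \<open>c j / x j\<close> is a sum of products of consecutive \<open>q i\<close>, and \<open>q j\<close> is
  the smallest of the factors.\<close>

lemma geometric_sum_le_c_ratio: "(\<Sum>i\<le>j. q j ^ i) \<le> c j / x j"
proof (induction j)
  case 0
  then show ?case using pos[of 0] by (simp add: c_def)
next
  case (Suc j)
  have "(\<Sum>i\<le>j. q (Suc j) ^ i) \<le> (\<Sum>i\<le>j. q j ^ i)"
    by (intro sum_mono power_mono q_Suc_le q_nonneg)
  also have "\<dots> \<le> c j / x j" by (rule Suc)
  finally have "q (Suc j) * (\<Sum>i\<le>j. q (Suc j) ^ i) \<le> q j * (c j / x j)"
    by (intro mult_mono q_Suc_le q_nonneg sum_nonneg zero_le_power) auto
  moreover have "(\<Sum>i\<le>Suc j. q (Suc j) ^ i) = q (Suc j) * (\<Sum>i\<le>j. q (Suc j) ^ i) + 1"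
    unfolding sum.atMost_Suc_shift by (simp add: sum_distrib_left)
  ultimately show ?case by (simp add: c_ratio_Suc)
qed

text \<open>Since \<open>q j\<close> is at most 1, \<open>c_ratio_Suc\<close> lets
  \<open>c j / x j\<close> grow by at most 1 per step. This later gives nonnegative
  coefficients.\<close>

lemma c_le_d: "c j \<le> d j"
proof -
  have "c j / x j \<le> real (j + 1)"
  proof (induction j)
    case 0
    then show ?case using pos[of 0] by (simp add: c_def)
  next
    case (Suc j)
    have "q j * (c j / x j) \<le> 1 * (c j / x j)"
      using q_le_1 pos c_pos by (intro mult_right_mono) (auto simp: less_imp_le)
    then show ?case using Suc by (simp add: c_ratio_Suc)
  qed
  then show ?thesis using pos[of j] by (simp add: d_def divide_le_eq)
qed

text \<open>After clearing denominators this is \<open>geometric_sum_inequality\<close> with q =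
  \<open>q j\<close> and r = \<open>c j / x j\<close>.\<close>

lemma decseq_c_div_d: "decseq (\<lambda>j. c j / d j)"
proof (rule decseq_SucI)
  fix j
  have "real (j + 1) * (c (Suc j) / x (Suc j)) \<le> real (j + 2) * (c j / x j)"
    unfolding c_ratio_Suc
    by (intro geometric_sum_inequality q_nonneg q_le_1 geometric_sum_le_c_ratio)
  then show "c (Suc j) / d (Suc j) \<le> c j / d j"
    using pos[of j] pos[of "Suc j"] by (simp add: d_def divide_simps) (simp add: algebra_simps)
qed

text \<open>Mediant principle: the new quotient \<open>c (Suc N) / d (Suc N)\<close> is below every
  earlier one, hence below their weighted average \<open>C N / D N\<close>, and including it pulls
  the average down.\<close>

lemma decseq_C_div_D: "decseq (\<lambda>N. C N / D N)"
proof (rule decseq_SucI)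
  fix N
  have "c (Suc N) * d j \<le> c j * d (Suc N)" if "j \<le> N" for j
    using decseqD[OF decseq_c_div_d, of j "Suc N"] that d_pos[of j] d_pos[of "Suc N"]
    by (simp add: divide_simps)
  then have "c (Suc N) * D N \<le> C N * d (Suc N)"
    unfolding C_def D_def sum_distrib_left sum_distrib_right by (intro sum_mono) auto
  then have "C (Suc N) * D N \<le> C N * D (Suc N)"
    by (simp add: C_def D_def algebra_simps)
  then show "C (Suc N) / D (Suc N) \<le> C N / D N"
    using D_pos[of N] D_pos[of "Suc N"] by (simp add: divide_simps)
qed

lemma C_le_D: "C N \<le> D N"
  unfolding C_def D_def by (intro sum_mono c_le_d)

lemma tendsto_C_div_D:
  assumes x: "x sums X" and d: "(\<lambda>k. real (k + 1) * x k) sums T"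
  shows "(\<lambda>N. C N / D N) \<longlonglongrightarrow> X / ((1 - \<eta>) * T)"
proof -
  have "summable (\<lambda>k. \<bar>x k\<bar>)"
    using x pos by (simp add: sums_iff less_imp_le)
  moreover have "summable (\<lambda>k. norm (\<eta> ^ k))"
    using \<eta> by (simp add: summable_geometric)
  ultimately have "(\<lambda>j. \<Sum>k\<le>j. x k * \<eta> ^ (j - k)) sums ((\<Sum>k. x k) * (\<Sum>k. \<eta> ^ k))"
    by (intro Cauchy_product_sums) simp_all
  then have "c sums (X / (1 - \<eta>))"
    using x \<eta> by (simp add: sums_iff suminf_geometric c_def[abs_def] mult.commute)
  then have C: "C \<longlonglongrightarrow> X / (1 - \<eta>)"
    unfolding C_def[abs_def] by (simp add: sums_def_le)
  have D: "D \<longlonglongrightarrow> T"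
    using d unfolding D_def[abs_def] d_def[abs_def] by (simp add: sums_def_le)
  \<comment> \<open>The terms of \<open>D\<close> are positive, so its limit stays above
    \<open>D 0\<close>; this makes the limiting denominator nonzero.\<close>
  have "D 0 \<le> T"
  proof (rule LIMSEQ_le_const[OF D])
    show "\<exists>N. \<forall>n\<ge>N. D 0 \<le> D n"
      unfolding D_def by (intro exI[of _ 0] allI impI sum_mono2) (auto simp: less_imp_le d_pos)
  qed
  then have "T > 0" using D_pos[of 0] by linarith
  then show ?thesis
    using tendsto_divide[OF C D] by simp
qed

lemma sum_weight_star: "(\<Sum>k=0..N. weight_star N k * x k) = D N"
  by (simp add: D_def d_def weight_star_def atLeast0AtMost)

text \<open>Summing the triangle k <= j <= N by k instead of j, \<open>C N\<close> gives
  \<open>x k\<close> the coefficient that \<open>weight\<close> subtracts from k + 1.\<close>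

lemma sum_weight:
  assumes "\<eta> = 1 - inverse \<alpha>"
  shows "(\<Sum>k=0..N. weight \<alpha> N k * x k) = D N - C N"
proof -
  have "C N = (\<Sum>k\<le>N. \<Sum>j=k..N. \<eta> ^ (j - k) * x k)"
    unfolding C_def c_def by (induction N) (simp_all add: sum.distrib)
  then show ?thesis
    by (simp add: D_def d_def weight_def assms[symmetric] atLeast0AtMost sum_distrib_right
        left_diff_distrib sum_subtractf)
qed

end

section \<open>Weighted spectral moments\<close>

text \<open>The spectral measure of \<open>X\<close> weighted by \<open>S\<close>: it puts mass \<open>W e\<close> on the eigenvalue \<open>l e\<close>.\<close>

definition spectral_weights ::
  "real^'n^'n \<Rightarrow> real^'n^'n \<Rightarrow> 'e set \<Rightarrow> ('e \<Rightarrow> real) \<Rightarrow> ('e \<Rightarrow> real) \<Rightarrow> bool" where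
  "spectral_weights S X E l W \<longleftrightarrow>
    finite E \<and> (\<forall>e\<in>E. 0 < l e \<and> l e < 1 \<and> 0 \<le> W e) \<and> (\<exists>e\<in>E. 0 < W e) \<and>
    (\<forall>k. trace (S ** mat_pow X k) = (\<Sum>e\<in>E. W e * l e ^ k)) \<and>
    (\<forall>Y. (mat 1 - X) ** Y = mat 1 \<longrightarrow>
       trace (S ** Y) = (\<Sum>e\<in>E. W e * (1 / (1 - l e))) \<and>
       trace (S ** (Y ** Y)) = (\<Sum>e\<in>E. W e * (1 / (1 - l e)\<^sup>2)))"

text \<open>\<open>S\<close> and \<open>X\<close> may fail to commute. In an eigenbasis of
  \<open>X\<close>, the trace of \<open>S\<close> times a matrix diagonal in that basis sees only
  the diagonal values e . Se, and these serve as weights.\<close>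

lemma spectral_weights_exist:
  fixes S X :: "real^'n^'n"
  assumes S: "pos_semidef S" "S \<noteq> 0" and X: "pos_def X" "pos_def (mat 1 - X)"
  shows "\<exists>(E :: (real^'n) set) l W. spectral_weights S X E l W"
proof -
  have "transpose X = X" using X by (simp add: pos_def_def)
  from symmetric_eigenbasis[OF this]
  obtain E l where E: "orthonormal_basis E" and l: "\<And>e. e \<in> E \<Longrightarrow> X *v e = l e *\<^sub>R e"
    by auto
  have fin: "finite E" and unit: "\<And>e. e \<in> E \<Longrightarrow> e \<bullet> e = 1"
    using E by (auto simp: orthonormal_basis_def dot_square_norm)
  have l01: "0 < l e \<and> l e < 1" if "e \<in> E" for e
  proof -
    have "e \<noteq> 0" using unit[OF that] by auto
    then have "0 < e \<bullet> (X *v e)" "0 < e \<bullet> ((mat 1 - X) *v e)"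
      using X unfolding pos_def_def by blast+
    then show ?thesis
      by (simp add: matrix_vector_mult_diff_rdistrib inner_diff_right l that unit)
  qed
  define W where "W e = e \<bullet> (S *v e)" for e
  have W: "0 \<le> W e" for e
    using S by (simp add: W_def pos_semidef_def)
  have trace: "trace (S ** Y) = (\<Sum>e\<in>E. W e * g e)"
    if "\<And>e. e \<in> E \<Longrightarrow> Y *v e = g e *\<^sub>R e" for Y g
    unfolding trace_orthonormal_basis[OF E] W_def
    by (intro sum.cong)
       (simp_all add: matrix_vector_mul_assoc[symmetric] that matrix_vector_mult_scaleR)
  \<comment> \<open>The weights add up to the trace of \<open>S\<close>, which is nonzero for a
    nonzero semidefinite matrix; so some weight is positive.\<close>
  have "trace S \<noteq> 0"
    using S pos_semidef_zero_trace by blast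
  then have "(\<Sum>e\<in>E. W e) \<noteq> 0"
    unfolding trace_orthonormal_basis[OF E] W_def .
  then have "\<exists>e\<in>E. W e \<noteq> 0"
    by (meson sum.neutral)
  then have pos: "\<exists>e\<in>E. 0 < W e"
    using W by (metis order_le_less)
  have "mat_pow X k *v e = l e ^ k *\<^sub>R e" if "e \<in> E" for e k
    by (induction k)
       (simp_all add: l that matrix_vector_mul_assoc[symmetric] matrix_vector_mult_scaleR)
  then have pow: "trace (S ** mat_pow X k) = (\<Sum>e\<in>E. W e * l e ^ k)" for k
    by (rule trace)
  have inv: "Y *v e = (1 / (1 - l e)) *\<^sub>R e" if "e \<in> E" "(mat 1 - X) ** Y = mat 1" for Y e
  proof -
    have "Y ** (mat 1 - X) = mat 1" using that(2) by (simp add: matrix_left_right_inverse)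
    then have "Y *v ((mat 1 - X) *v e) = e" by (simp add: matrix_vector_mul_assoc)
    then have "(1 - l e) *\<^sub>R (Y *v e) = e"
      by (simp add: matrix_vector_mult_diff_rdistrib matrix_vector_mult_diff_distrib
          l that(1) matrix_vector_mult_scaleR scaleR_diff_left)
    then show ?thesis
      using l01[OF that(1)] by (metis diff_gt_0_iff_gt divideR_right inverse_eq_divide less_irrefl)
  qed
  have "trace (S ** Y) = (\<Sum>e\<in>E. W e * (1 / (1 - l e)))"
    "trace (S ** (Y ** Y)) = (\<Sum>e\<in>E. W e * (1 / (1 - l e)\<^sup>2))"
    if "(mat 1 - X) ** Y = mat 1" for Y
    by (intro trace, simp add: inv that matrix_vector_mul_assoc[symmetric]
        matrix_vector_mult_scaleR power2_eq_square)+
  then have "spectral_weights S X E l W"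
    unfolding spectral_weights_def using fin l01 W pos pow by blast
  then show ?thesis by blast
qed

context
  fixes S X Y :: "real^'n^'n"
  assumes S: "pos_semidef S" "S \<noteq> 0" and X: "pos_def X" "pos_def (mat 1 - X)"
begin

text \<open>The quadratic is the weighted sum of l^k (t l - 1)^2. Log-convexity is recorded as this
  family over \<open>t\<close> because it is linear in the traces and thus survives taking
  expectations, unlike an inequality between products.\<close>

lemma trace_moment_pos: "0 < trace (S ** mat_pow X k)"
  and trace_moment_quadratic:
    "0 \<le> t\<^sup>2 * trace (S ** mat_pow X (k + 2)) - 2 * t * trace (S ** mat_pow X (k + 1))
         + trace (S ** mat_pow X k)"
proof -
  obtain E :: "(real^'n) set" and l W where E: "spectral_weights S X E l W"
    using spectral_weights_exist[OF S X] by blast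
  have fin: "finite E" and lW: "\<And>e. e \<in> E \<Longrightarrow> 0 < l e \<and> l e < 1 \<and> 0 \<le> W e"
    and m: "\<And>k. trace (S ** mat_pow X k) = (\<Sum>e\<in>E. W e * l e ^ k)"
    and "\<exists>e\<in>E. 0 < W e"
    using E unfolding spectral_weights_def by blast+
  then obtain f where f: "f \<in> E" "0 < W f" by blast
  show "0 < trace (S ** mat_pow X k)"
    unfolding m using lW f fin by (intro sum_pos2[of E f]) (auto simp: less_imp_le)
  have "t\<^sup>2 * trace (S ** mat_pow X (k + 2)) - 2 * t * trace (S ** mat_pow X (k + 1))
      + trace (S ** mat_pow X k) = (\<Sum>e\<in>E. W e * l e ^ k * (t * l e - 1)\<^sup>2)"
    unfolding m sum_distrib_left sum_subtractf[symmetric] sum.distrib[symmetric]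
    by (intro sum.cong) (simp_all add: power2_eq_square algebra_simps)
  then show "0 \<le> t\<^sup>2 * trace (S ** mat_pow X (k + 2)) - 2 * t * trace (S ** mat_pow X (k + 1))
      + trace (S ** mat_pow X k)"
    using lW by (auto intro!: sum_nonneg mult_nonneg_nonneg simp: less_imp_le)
qed

text \<open>On each eigenvalue these are the geometric series and its derivative; finitely many of
  them are added.\<close>

lemma trace_moment_sums:
  assumes Y: "(mat 1 - X) ** Y = mat 1"
  shows "(\<lambda>k. trace (S ** mat_pow X k)) sums trace (S ** Y)"
    and "(\<lambda>k. real (k + 1) * trace (S ** mat_pow X k)) sums trace (S ** (Y ** Y))"
proof -
  obtain E :: "(real^'n) set" and l W where E: "spectral_weights S X E l W"
    using spectral_weights_exist[OF S X] by blast
  have lW: "\<And>e. e \<in> E \<Longrightarrow> 0 < l e \<and> l e < 1 \<and> 0 \<le> W e"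
    and m: "\<And>k. trace (S ** mat_pow X k) = (\<Sum>e\<in>E. W e * l e ^ k)"
    and Y': "trace (S ** Y) = (\<Sum>e\<in>E. W e * (1 / (1 - l e)))"
      "trace (S ** (Y ** Y)) = (\<Sum>e\<in>E. W e * (1 / (1 - l e)\<^sup>2))"
    using E Y unfolding spectral_weights_def by blast+
  have l: "norm (l e) < 1" if "e \<in> E" for e
    using lW[OF that] by simp
  show "(\<lambda>k. trace (S ** mat_pow X k)) sums trace (S ** Y)"
    unfolding m Y' using l by (intro sums_sum sums_mult geometric_sums)
  have "real (k + 1) * trace (S ** mat_pow X k) = (\<Sum>e\<in>E. W e * (of_nat (Suc k) * l e ^ k))" for k
    unfolding m sum_distrib_left by (intro sum.cong) simp_all
  then show "(\<lambda>k. real (k + 1) * trace (S ** mat_pow X k)) sums trace (S ** (Y ** Y))"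
    unfolding Y' using l by (simp only:) (intro sums_sum sums_mult geometric_deriv_sums)
qed

end

section \<open>Measurability and integrability of random matrices\<close>

lemma borel_measurable_matrix_mult [measurable (raw)]:
  fixes f :: "'w \<Rightarrow> real^'n^'m" and g :: "'w \<Rightarrow> real^'p^'n"
  assumes "f \<in> borel_measurable M" "g \<in> borel_measurable M"
  shows "(\<lambda>\<omega>. f \<omega> ** g \<omega>) \<in> borel_measurable M"
  using assms
  by (rule borel_measurable_continuous_Pair)
     (intro matrix_mult.continuous_on continuous_intros)

lemma continuous_on_trace: "continuous_on A (trace :: real^'n^'n \<Rightarrow> real)"
  by (intro linear_continuous_on bounded_linear_trace)

lemma borel_measurable_trace [measurable (raw)]:
  fixes f :: "'w \<Rightarrow> real^'n^'n"
  assumes "f \<in> borel_measurable M"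
  shows "(\<lambda>\<omega>. trace (f \<omega>)) \<in> borel_measurable M"
  by (rule measurable_compose[OF assms borel_measurable_continuous_onI[OF continuous_on_trace]])

lemma continuous_on_mat_pow:
  "continuous_on A (\<lambda>X :: real^'n^'n. mat_pow X k)"
  by (induction k) (auto intro!: continuous_intros matrix_mult.continuous_on)

lemma borel_measurable_mat_pow [measurable (raw)]:
  fixes f :: "'w \<Rightarrow> real^'n^'n"
  assumes "f \<in> borel_measurable M"
  shows "(\<lambda>\<omega>. mat_pow (f \<omega>) k) \<in> borel_measurable M"
  by (rule measurable_compose[OF assms borel_measurable_continuous_onI[OF continuous_on_mat_pow]])

lemma borel_measurable_vec_nth [measurable (raw)]:
  fixes f :: "'w \<Rightarrow> 'a::{second_countable_topology,real_normed_vector}^'n"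
  assumes "f \<in> borel_measurable M"
  shows "(\<lambda>\<omega>. f \<omega> $ i) \<in> borel_measurable M"
  by (rule measurable_compose[OF assms])
     (intro borel_measurable_continuous_onI linear_continuous_on bounded_linear_vec_nth)

text \<open>Cramer's rule, column by column. The explicit quotient of determinants is what makes
  \<open>matrix_inv\<close> measurable.\<close>

lemma matrix_inv_cofactor:
  fixes P :: "real^'n^'n"
  assumes "det P \<noteq> 0"
  shows "matrix_inv P = (\<chi> k j. det (\<chi> a b. if b = k then (if a = j then 1 else 0) else P $ a $ b) / det P)"
    (is "_ = ?Q")
proof (rule matrix_inv_unique)
  have "column j (P ** ?Q) = column j (mat 1)" for j
  proof -
    have "column j (P ** ?Q) = P *v column j ?Q"
      by (simp add: vec_eq_iff column_def matrix_matrix_mult_def matrix_vector_mult_def)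
    also have "\<dots> = axis j 1"
      by (subst cramer[OF assms]) (simp add: vec_eq_iff column_def axis_def cong: if_cong)
    also have "\<dots> = column j (mat 1)"
      by (simp add: vec_eq_iff column_def axis_def mat_def)
    finally show ?thesis .
  qed
  then show "P ** ?Q = mat 1"
    by (simp add: vec_eq_iff column_def)
qed

lemma borel_measurable_det:
  fixes f :: "'w \<Rightarrow> real^'n^'n"
  assumes "\<And>i j. (\<lambda>\<omega>. f \<omega> $ i $ j) \<in> borel_measurable M"
  shows "(\<lambda>\<omega>. det (f \<omega>)) \<in> borel_measurable M"
  unfolding det_def using assms by measurable

lemma borel_measurable_vec_lambda:
  fixes f :: "'w \<Rightarrow> 'n::finite \<Rightarrow> 'a::euclidean_space"
  assumes "\<And>i. (\<lambda>\<omega>. f \<omega> i) \<in> borel_measurable M"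
  shows "(\<lambda>\<omega>. \<chi> i. f \<omega> i) \<in> borel_measurable M"
proof (rule borel_measurable_euclidean_space[THEN iffD2], intro ballI)
  fix b :: "'a^'n" assume "b \<in> Basis"
  then obtain i u where "b = axis i u" by (auto simp: Basis_vec_def)
  then show "(\<lambda>\<omega>. (\<chi> i. f \<omega> i) \<bullet> b) \<in> borel_measurable M"
    using assms by (simp add: inner_axis)
qed

text \<open>The inverse is a rational function of the entries where the determinant is nonzero and
  constant where it vanishes; the two measurable pieces are glued.\<close>

lemma borel_measurable_matrix_inv [measurable (raw)]:
  fixes f :: "'w \<Rightarrow> real^'n^'n"
  assumes f [measurable]: "f \<in> borel_measurable M"
  shows "(\<lambda>\<omega>. matrix_inv (f \<omega>)) \<in> borel_measurable M"
proof -
  define Q where "Q \<omega> = (\<chi> k j. det (\<chi> a b. if b = k then (if a = j then 1 else 0)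
      else f \<omega> $ a $ b) / det (f \<omega>))" for \<omega>
  \<comment> \<open>On singular matrices \<open>matrix_inv\<close> is one and the same junk value.\<close>
  define J :: "real^'n^'n" where "J = (SOME B. False)"
  have "matrix_inv (f \<omega>) = (if det (f \<omega>) = 0 then J else Q \<omega>)" for \<omega>
  proof (cases "det (f \<omega>) = 0")
    case True
    then have "\<not> (\<exists>B. f \<omega> ** B = mat 1 \<and> B ** f \<omega> = mat 1)"
      by (metis invertible_def invertible_det_nz)
    then have "(\<lambda>B. f \<omega> ** B = mat 1 \<and> B ** f \<omega> = mat 1) = (\<lambda>B. False)"
      by blast
    then show ?thesis
      using True by (simp only: matrix_inv_def J_def if_True refl)
  next
    case False
    then show ?thesis by (simp add: Q_def matrix_inv_cofactor)
  qed
  moreover have [measurable]: "(\<lambda>\<omega>. det (f \<omega>)) \<in> borel_measurable M"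
    by (rule borel_measurable_det) measurable
  moreover have [measurable]: "Q \<in> borel_measurable M"
    unfolding Q_def
    by (intro borel_measurable_vec_lambda borel_measurable_divide borel_measurable_det) (auto split: if_splits)
  ultimately show ?thesis
    by (simp only:) measurable
qed

lemma integrable_matrix_entry:
  fixes f :: "'w \<Rightarrow> real^'n^'m"
  assumes "integrable M f"
  shows "integrable M (\<lambda>\<omega>. f \<omega> $ i $ j)"
    and "(\<integral>\<omega>. f \<omega> $ i $ j \<partial>M) = (\<integral>\<omega>. f \<omega> \<partial>M) $ i $ j"
proof -
  have "bounded_linear (\<lambda>P :: real^'n^'m. P $ i $ j)"
    by (intro bounded_linear_compose[OF bounded_linear_vec_nth bounded_linear_vec_nth])
  from integrable_bounded_linear[OF this assms] integral_bounded_linear[OF this assms]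
  show "integrable M (\<lambda>\<omega>. f \<omega> $ i $ j)" "(\<integral>\<omega>. f \<omega> $ i $ j \<partial>M) = (\<integral>\<omega>. f \<omega> \<partial>M) $ i $ j"
    by auto
qed

lemma trace_matrix_mult: "trace (P ** Q) = (\<Sum>i\<in>UNIV. \<Sum>j\<in>UNIV. P $ i $ j * Q $ j $ i)"
  by (simp add: trace_def matrix_matrix_mult_def)

text \<open>Preimages under g(X) and h(Y) are events of the sigma-algebras generated by
  \<open>X\<close> and \<open>Y\<close>, so independence passes to these two real variables, where
  the product rule for \<open>indep_var\<close> applies.\<close>

lemma (in prob_space) indep_rv_integral_mult:
  fixes X :: "'a \<Rightarrow> 'b::topological_space" and Y :: "'a \<Rightarrow> 'c::topological_space"
    and g :: "'b \<Rightarrow> real" and h :: "'c \<Rightarrow> real"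
  assumes indep: "indep_rv M X Y"
    and X: "X \<in> borel_measurable M" and Y: "Y \<in> borel_measurable M"
    and g: "g \<in> borel_measurable borel" and h: "h \<in> borel_measurable borel"
    and int: "integrable M (\<lambda>\<omega>. g (X \<omega>))" "integrable M (\<lambda>\<omega>. h (Y \<omega>))"
  shows "(\<integral>\<omega>. g (X \<omega>) * h (Y \<omega>) \<partial>M) = (\<integral>\<omega>. g (X \<omega>) \<partial>M) * (\<integral>\<omega>. h (Y \<omega>) \<partial>M)"
    and "integrable M (\<lambda>\<omega>. g (X \<omega>) * h (Y \<omega>))"
proof -
  have sets: "sets (vimage_algebra (space M) Z borel) = {Z -` B \<inter> space M | B. B \<in> sets borel}"
    for Z :: "'a \<Rightarrow> 'e::topological_space"
    by (simp add: sets_vimage_algebra2)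
  let ?G = "{(\<lambda>\<omega>. g (X \<omega>)) -` B \<inter> space M | B. B \<in> sets borel}"
  let ?H = "{(\<lambda>\<omega>. h (Y \<omega>)) -` B \<inter> space M | B. B \<in> sets borel}"
  have G: "?G \<subseteq> sets (vimage_algebra (space M) X borel)"
  proof safe
    fix B :: "real set" assume "B \<in> sets borel"
    then have "g -` B \<in> sets borel" using measurable_sets[OF g] by simp
    then show "(\<lambda>\<omega>. g (X \<omega>)) -` B \<inter> space M \<in> sets (vimage_algebra (space M) X borel)"
      unfolding sets by (intro CollectI exI[of _ "g -` B"]) auto
  qed
  have H: "?H \<subseteq> sets (vimage_algebra (space M) Y borel)"
  proof safe
    fix B :: "real set" assume "B \<in> sets borel"
    then have "h -` B \<in> sets borel" using measurable_sets[OF h] by simp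
    then show "(\<lambda>\<omega>. h (Y \<omega>)) -` B \<inter> space M \<in> sets (vimage_algebra (space M) Y borel)"
      unfolding sets by (intro CollectI exI[of _ "h -` B"]) auto
  qed
  have "indep_set ?G ?H"
    unfolding indep_set_def
  proof (rule indep_sets_mono_sets[OF indep[unfolded indep_rv_def indep_set_def]])
    show "case_bool ?G ?H b \<subseteq> case_bool (sets (vimage_algebra (space M) X borel))
        (sets (vimage_algebra (space M) Y borel)) b" for b
      using G H by (cases b) simp_all
  qed
  moreover have "Int_stable {Z -` B \<inter> space M | B. B \<in> sets borel}" for Z :: "'a \<Rightarrow> real"
  proof (rule Int_stableI, elim CollectE exE conjE)
    fix a b and B C :: "real set"
    assume "a = Z -` B \<inter> space M" "B \<in> sets borel" "b = Z -` C \<inter> space M" "C \<in> sets borel"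
    then show "a \<inter> b \<in> {Z -` B \<inter> space M | B. B \<in> sets borel}"
      by (intro CollectI exI[of _ "B \<inter> C"]) auto
  qed
  ultimately have "indep_var borel (\<lambda>\<omega>. g (X \<omega>)) borel (\<lambda>\<omega>. h (Y \<omega>))"
    unfolding indep_var_eq
    by (intro conjI indep_set_sigma_sets measurable_compose[OF X g] measurable_compose[OF Y h])
  from indep_var_lebesgue_integral[OF this int] indep_var_integrable[OF this int]
  show "(\<integral>\<omega>. g (X \<omega>) * h (Y \<omega>) \<partial>M) = (\<integral>\<omega>. g (X \<omega>) \<partial>M) * (\<integral>\<omega>. h (Y \<omega>) \<partial>M)"
    "integrable M (\<lambda>\<omega>. g (X \<omega>) * h (Y \<omega>))" by auto
qed

lemma norm_matrix_le_sum: "norm (P :: real^'n^'m) \<le> (\<Sum>i\<in>UNIV. \<Sum>j\<in>UNIV. \<bar>P $ i $ j\<bar>)"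
proof -
  have "norm P \<le> (\<Sum>i\<in>UNIV. norm (P $ i))"
    unfolding norm_vec_def by (intro L2_set_le_sum) auto
  also have "\<dots> \<le> (\<Sum>i\<in>UNIV. \<Sum>j\<in>UNIV. \<bar>P $ i $ j\<bar>)"
    by (intro sum_mono norm_le_l1_cart)
  finally show ?thesis .
qed

text \<open>The norm of the type is the Frobenius norm. This turns integrability of the squared
  inverse into square integrability of the norm of the inverse.\<close>

lemma norm_symmetric_matrix_sq:
  assumes "transpose P = P"
  shows "(norm (P :: real^'n^'n))\<^sup>2 = trace (P ** P)"
proof -
  have "P $ j $ i = P $ i $ j" for i j
  proof -
    have "P $ j $ i = transpose P $ i $ j" by (simp add: transpose_def)
    then show ?thesis using assms by simp
  qed
  then show ?thesis
    unfolding power2_norm_eq_inner trace_matrix_mult by (simp add: inner_vec_def)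
qed

text \<open>The partial sums are dominated by the integrable total \<open>g\<close>, so dominated
  convergence applies.\<close>

lemma sums_integral_nonneg:
  fixes f :: "nat \<Rightarrow> 'w \<Rightarrow> real"
  assumes f: "\<And>k. integrable M (f k)" and g: "integrable M g"
    and sums: "AE \<omega> in M. (\<forall>k. 0 \<le> f k \<omega>) \<and> (\<lambda>k. f k \<omega>) sums g \<omega>"
  shows "(\<lambda>k. \<integral>\<omega>. f k \<omega> \<partial>M) sums (\<integral>\<omega>. g \<omega> \<partial>M)"
proof -
  have "(\<lambda>n. \<integral>\<omega>. (\<Sum>k<n. f k \<omega>) \<partial>M) \<longlonglongrightarrow> (\<integral>\<omega>. g \<omega> \<partial>M)"
  proof (rule integral_dominated_convergence[where w = g])
    show "AE \<omega> in M. (\<lambda>n. \<Sum>k<n. f k \<omega>) \<longlonglongrightarrow> g \<omega>"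
      using sums by eventually_elim (simp add: sums_def)
    show "AE \<omega> in M. norm (\<Sum>k<n. f k \<omega>) \<le> g \<omega>" for n
      using sums
    proof eventually_elim
      case (elim \<omega>)
      then have "(\<Sum>k<n. f k \<omega>) \<le> g \<omega>"
        using sum_le_suminf[of "\<lambda>k. f k \<omega>" "{..<n}"] by (auto simp: sums_iff)
      then show ?case using elim by (simp add: sum_nonneg)
    qed
  qed (use f g in auto)
  then show ?thesis
    using f by (simp add: sums_def)
qed

lemma pos_def_scaleR: "0 < c \<Longrightarrow> pos_def P \<Longrightarrow> pos_def (c *\<^sub>R P)"
  by (simp add: pos_def_def transpose_scalar scaleR_matrix_vector_assoc[symmetric])

text \<open>The product itself may fail to be symmetric, but by cyclicity its trace is that of the
  semidefinite congruence of \<open>Q\<close> by the root of \<open>P\<close>.\<close>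

lemma trace_mult_pos_semidef:
  assumes "pos_semidef P" "pos_semidef Q"
  shows "0 \<le> trace (P ** Q)"
proof -
  have "transpose (mat_sqrt P) = mat_sqrt P"
    using pos_semidef_mat_sqrt(1)[OF assms(1)] by (simp add: pos_semidef_def)
  then show ?thesis
    using trace_pos_semidef_nonneg[OF pos_semidef_congruence[OF _ assms(2)]]
      trace_mat_sqrt_conj[OF assms(1)] by metis
qed

section \<open>Quadratic forms in an independent vector\<close>

text \<open>Entrywise the form is a sum of products of an entry of h(X) and an entry of the outer
  product, and each expectation factors by independence.\<close>

lemma (in prob_space) indep_quadratic_form:
  fixes X :: "'a \<Rightarrow> 'b::topological_space" and h :: "'b \<Rightarrow> real^'n^'n" and q :: "'a \<Rightarrow> real^'n"
  assumes X: "X \<in> borel_measurable M" and q: "q \<in> borel_measurable M" and indep: "indep_rv M X q"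
    and h: "h \<in> borel_measurable borel" "integrable M (\<lambda>\<omega>. h (X \<omega>))"
    and outer: "integrable M (\<lambda>\<omega>. outer_product (q \<omega>))"
  shows "(\<integral>\<omega>. q \<omega> \<bullet> (h (X \<omega>) *v q \<omega>) \<partial>M) =
      trace ((\<integral>\<omega>. outer_product (q \<omega>) \<partial>M) ** (\<integral>\<omega>. h (X \<omega>) \<partial>M))" (is ?eq)
    and "integrable M (\<lambda>\<omega>. q \<omega> \<bullet> (h (X \<omega>) *v q \<omega>))" (is ?int)
proof -
  have quad: "q \<omega> \<bullet> (h (X \<omega>) *v q \<omega>) =
      (\<Sum>i\<in>UNIV. \<Sum>j\<in>UNIV. h (X \<omega>) $ j $ i * (q \<omega> $ i * q \<omega> $ j))" for \<omega>
    unfolding inner_vec_def matrix_vector_mult_def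
    by (subst sum.swap) (simp add: sum_distrib_left mult_ac)
  have hij: "(\<lambda>b. h b $ j $ i) \<in> borel_measurable borel" for i j
    using h(1) by measurable
  have qij: "(\<lambda>v :: real^'n. v $ i * v $ j) \<in> borel_measurable borel" for i j
    by measurable
  have outer': "integrable M (\<lambda>\<omega>. q \<omega> $ i * q \<omega> $ j)"
    "(\<integral>\<omega>. q \<omega> $ i * q \<omega> $ j \<partial>M) = (\<integral>\<omega>. outer_product (q \<omega>) \<partial>M) $ i $ j" for i j
    using integrable_matrix_entry[OF outer, of i j] by (simp_all add: outer_product_def)
  note prod = indep_rv_integral_mult[OF indep X q hij qij integrable_matrix_entry(1)[OF h(2)] outer'(1)]
  show ?int
    unfolding quad by (intro Bochner_Integration.integrable_sum prod(2))
  have "(\<integral>\<omega>. q \<omega> \<bullet> (h (X \<omega>) *v q \<omega>) \<partial>M) = (\<Sum>i\<in>UNIV. \<Sum>j\<in>UNIV.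
      (\<integral>\<omega>. h (X \<omega>) \<partial>M) $ j $ i * (\<integral>\<omega>. outer_product (q \<omega>) \<partial>M) $ i $ j)"
    unfolding quad
    by (simp add: Bochner_Integration.integral_sum Bochner_Integration.integrable_sum prod
        outer'(2) integrable_matrix_entry(2)[OF h(2)])
  then show ?eq
    unfolding trace_matrix_mult by (simp add: mult.commute)
qed

section \<open>The estimator\<close>

locale random_matrix_estimator = prob_space M for M :: "'w measure" +
  fixes A R :: "real^'n^'n" and Ahat :: "'w \<Rightarrow> real^'n^'n" and \<alpha> :: real
  assumes A: "pos_def A"
    and Ahat_measurable [measurable]: "Ahat \<in> borel_measurable M"
    and Ahat_pos_def: "AE \<omega> in M. pos_def (Ahat \<omega>)"
    and mean_le: "(\<integral>\<omega>. Ahat \<omega> \<partial>M) \<preceq>\<^sub>L A"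
    and inv_sq_integrable: "integrable M (\<lambda>\<omega>. matrix_inv (Ahat \<omega>) ** matrix_inv (Ahat \<omega>))"
    and \<alpha>: "\<alpha> \<ge> 1"
    and Ahat_less: "AE \<omega> in M. Ahat \<omega> \<prec>\<^sub>L \<alpha> *\<^sub>R A"
    and R: "pos_semidef R" "R \<noteq> 0"
begin

definition A_sqrt :: "real^'n^'n" where "A_sqrt = mat_sqrt A"

definition A_isqrt :: "real^'n^'n" where "A_isqrt = matrix_inv (mat_sqrt A)"

definition K :: "'w \<Rightarrow> real^'n^'n" where "K \<omega> = matrix_inv (Ahat \<omega>)"

definition S :: "real^'n^'n" where "S = A_isqrt ** R ** A_isqrt"

definition X :: "'w \<Rightarrow> real^'n^'n" where
  "X \<omega> = mat 1 - inverse \<alpha> *\<^sub>R (A_isqrt ** Ahat \<omega> ** A_isqrt)"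

text \<open>Almost surely the inverse of \<open>mat 1 - X\<close>.\<close>

definition Y :: "'w \<Rightarrow> real^'n^'n" where "Y \<omega> = \<alpha> *\<^sub>R (A_sqrt ** K \<omega> ** A_sqrt)"

definition moment :: "nat \<Rightarrow> real" where
  "moment k = (\<integral>\<omega>. trace (S ** mat_pow (X \<omega>) k) \<partial>M)"

definition KAK_mean :: real where "KAK_mean = (\<integral>\<omega>. trace (R ** (K \<omega> ** A ** K \<omega>)) \<partial>M)"

definition K_mean :: real where "K_mean = (\<integral>\<omega>. trace (R ** K \<omega>) \<partial>M)"

section \<open>Conjugation by the square root of \<open>A\<close>\<close>

lemma \<alpha>_pos: "\<alpha> > 0"
  using \<alpha> by simp

lemma A_sqrt: "pos_def A_sqrt" "A_sqrt ** A_sqrt = A" "transpose A_sqrt = A_sqrt"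
  using pos_def_mat_sqrt[OF A] pos_semidef_mat_sqrt(2)[OF pos_def_imp_pos_semidef[OF A]]
  by (simp_all add: A_sqrt_def pos_def_def)

lemma A_isqrt: "A_sqrt ** A_isqrt = mat 1" "A_isqrt ** A_sqrt = mat 1" "transpose A_isqrt = A_isqrt"
  unfolding A_isqrt_def A_sqrt_def using matrix_inv_pos_def[OF pos_def_mat_sqrt[OF A]] by auto

lemma A_isqrt_cancel: "P ** A_sqrt ** A_isqrt = P" "P ** A_isqrt ** A_sqrt = P"
    "P ** A_sqrt ** A_sqrt = P ** A"
  by (simp_all add: matrix_mul_assoc[symmetric] A_isqrt A_sqrt(2))

lemma A_mult_A_isqrt: "A ** A_isqrt = A_sqrt"
  using A_isqrt_cancel(1)[of A_sqrt] by (simp add: A_sqrt(2))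

lemma A_isqrt_sq: "matrix_inv A = A_isqrt ** A_isqrt"
  by (rule matrix_inv_unique) (simp add: matrix_mul_assoc A_mult_A_isqrt A_isqrt(1))

lemma A_isqrt_A: "A_isqrt ** A ** A_isqrt = mat 1"
  by (simp add: matrix_mul_assoc[symmetric] A_mult_A_isqrt A_isqrt)

lemma S: "pos_semidef S" "S \<noteq> 0"
proof -
  show "pos_semidef S"
    unfolding S_def by (rule pos_semidef_congruence[OF A_isqrt(3) R(1)])
  have "A_sqrt ** S ** A_sqrt = R"
    by (simp add: S_def matrix_mul_assoc A_isqrt A_isqrt_cancel)
  then show "S \<noteq> 0" using R(2) by auto
qed

lemma trace_S: "trace (S ** P) = trace (R ** (A_isqrt ** P ** A_isqrt))"
  using trace_mul_sym[of A_isqrt "R ** A_isqrt ** P"] by (simp add: S_def matrix_mul_assoc)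

lemma X_eq: "X \<omega> = inverse \<alpha> *\<^sub>R (- (A_isqrt ** (Ahat \<omega> - \<alpha> *\<^sub>R A) ** A_isqrt))"
  using \<alpha>_pos
  by (simp add: X_def matrix_mult.diff_left matrix_mult.diff_right matrix_mult.scaleR_left
      matrix_mult.scaleR_right A_isqrt_A scaleR_diff_right)

lemma X_pos_def: "pos_def (Ahat \<omega>) \<Longrightarrow> pos_def (mat 1 - X \<omega>)"
  unfolding X_def using \<alpha>_pos
  by (simp add: pos_def_scaleR pos_def_congruence[OF A_isqrt(3) A_isqrt(1)])

lemma X_less_pos_def:
  assumes "Ahat \<omega> \<prec>\<^sub>L \<alpha> *\<^sub>R A"
  shows "pos_def (X \<omega>)"
proof -
  have "pos_def (A_isqrt ** (\<alpha> *\<^sub>R A - Ahat \<omega>) ** A_isqrt)"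
    using assms by (intro pos_def_congruence[OF A_isqrt(3) A_isqrt(1)]) (simp add: loewner_less_def)
  moreover have "X \<omega> = inverse \<alpha> *\<^sub>R (A_isqrt ** (\<alpha> *\<^sub>R A - Ahat \<omega>) ** A_isqrt)"
    unfolding X_eq by (simp add: matrix_mult.diff_left matrix_mult.diff_right)
  ultimately show ?thesis
    using \<alpha>_pos by (simp add: pos_def_scaleR)
qed

text \<open>The inverse roots in \<open>S\<close> cancel the roots in \<open>Y\<close>, leaving the
  weight \<open>R\<close>. Squaring \<open>Y\<close> brings two roots together in the middle, which
  is where the \<open>A\<close> between the two factors \<open>K\<close> comes from.\<close>

lemma Y:
  assumes "pos_def (Ahat \<omega>)"
  shows "(mat 1 - X \<omega>) ** Y \<omega> = mat 1"
    and "trace (S ** Y \<omega>) = \<alpha> * trace (R ** K \<omega>)"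
    and "trace (S ** (Y \<omega> ** Y \<omega>)) = \<alpha>\<^sup>2 * trace (R ** (K \<omega> ** A ** K \<omega>))"
proof -
  have K: "P ** Ahat \<omega> ** K \<omega> = P" for P
    unfolding K_def using matrix_inv_pos_def(1)[OF assms] by (simp add: matrix_mul_assoc[symmetric])
  show "(mat 1 - X \<omega>) ** Y \<omega> = mat 1"
    using \<alpha>_pos
    by (simp add: X_def Y_def matrix_mult.scaleR_left matrix_mult.scaleR_right matrix_mul_assoc
        A_isqrt_cancel K A_isqrt)
  show "trace (S ** Y \<omega>) = \<alpha> * trace (R ** K \<omega>)"
    unfolding trace_S Y_def
    by (simp add: matrix_mult.scaleR_left matrix_mult.scaleR_right matrix_mul_assoc
        A_isqrt_cancel trace_scaleR A_isqrt)
  have "Y \<omega> ** Y \<omega> = \<alpha>\<^sup>2 *\<^sub>R (A_sqrt ** (K \<omega> ** A ** K \<omega>) ** A_sqrt)"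
    by (simp add: Y_def matrix_mult.scaleR_left matrix_mult.scaleR_right matrix_mul_assoc
        A_isqrt_cancel(3) power2_eq_square)
  then show "trace (S ** (Y \<omega> ** Y \<omega>)) = \<alpha>\<^sup>2 * trace (R ** (K \<omega> ** A ** K \<omega>))"
    unfolding trace_S
    by (simp add: matrix_mult.scaleR_left matrix_mult.scaleR_right matrix_mul_assoc
        A_isqrt_cancel trace_scaleR A_isqrt)
qed

section \<open>Measurability and integrability of the estimator\<close>

lemma K_measurable [measurable]: "K \<in> borel_measurable M"
  unfolding K_def by measurable

lemma X_measurable [measurable]: "X \<in> borel_measurable M"
  unfolding X_def by measurable

text \<open>The diagonal of \<open>Ahat\<close> lies below that of
  \<open>\<alpha> *\<^sub>R A\<close>, and semidefiniteness controls the other entries by the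
  diagonal.\<close>

lemma norm_Ahat_bounded: "\<exists>b. AE \<omega> in M. norm (Ahat \<omega>) \<le> b"
proof -
  define b where "b = (\<Sum>i\<in>UNIV. \<Sum>j\<in>UNIV. \<alpha> * (A $ i $ i + A $ j $ j) / 2)"
  have "AE \<omega> in M. norm (Ahat \<omega>) \<le> b"
    using Ahat_pos_def Ahat_less
  proof eventually_elim
    case (elim \<omega>)
    have "pos_semidef (\<alpha> *\<^sub>R A - Ahat \<omega>)"
      using elim(2) by (intro pos_def_imp_pos_semidef) (simp add: loewner_less_def)
    then have "0 \<le> axis i 1 \<bullet> ((\<alpha> *\<^sub>R A - Ahat \<omega>) *v axis i 1)" for i
      by (simp add: pos_semidef_def)
    then have diag: "Ahat \<omega> $ i $ i \<le> \<alpha> * A $ i $ i" for i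
      unfolding inner_axis_matrix by simp
    have "\<bar>Ahat \<omega> $ i $ j\<bar> \<le> \<alpha> * (A $ i $ i + A $ j $ j) / 2" for i j
      using pos_semidef_entry_bound[OF pos_def_imp_pos_semidef[OF elim(1)], of i j] diag[of i] diag[of j]
      by (simp add: distrib_left)
    then show "norm (Ahat \<omega>) \<le> b"
      using norm_matrix_le_sum[of "Ahat \<omega>"] unfolding b_def
      by (meson order_trans sum_mono)
  qed
  then show ?thesis by blast
qed

lemma Ahat_integrable: "integrable M Ahat"
  using norm_Ahat_bounded by (auto intro: integrable_const_bound)

text \<open>The power is a continuous function of \<open>Ahat\<close>, hence bounded on a compact
  ball containing almost all of its values.\<close>

lemma mat_pow_X_integrable: "integrable M (\<lambda>\<omega>. mat_pow (X \<omega>) k)"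
proof -
  obtain b where b: "AE \<omega> in M. norm (Ahat \<omega>) \<le> b"
    using norm_Ahat_bounded by blast
  define f where "f P = mat_pow (mat 1 - inverse \<alpha> *\<^sub>R (A_isqrt ** P ** A_isqrt)) k" for P :: "real^'n^'n"
  have "continuous_on (cball 0 b) f"
    unfolding f_def
    by (rule continuous_on_compose2[OF continuous_on_mat_pow[of UNIV]])
       (auto intro!: continuous_intros matrix_mult.continuous_on)
  then have "bounded (f ` cball 0 b)"
    by (intro compact_imp_bounded compact_continuous_image compact_cball)
  then obtain c where "\<forall>P\<in>cball 0 b. norm (f P) \<le> c"
    by (auto simp: bounded_iff)
  then have "AE \<omega> in M. norm (mat_pow (X \<omega>) k) \<le> c"
    using b by (auto simp: X_def f_def elim!: eventually_mono)
  then show ?thesis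
    by (rule integrable_const_bound) measurable
qed

lemma trace_mult_bounded_linear: "bounded_linear (\<lambda>Q :: real^'n^'n. trace (P ** Q))"
  by (rule bounded_linear_compose[OF bounded_linear_trace matrix_mult.bounded_linear_right])

lemma moment_integrable: "integrable M (\<lambda>\<omega>. trace (S ** mat_pow (X \<omega>) k))"
  by (rule integrable_bounded_linear[OF trace_mult_bounded_linear mat_pow_X_integrable])

lemma norm_K_sq_integrable: "integrable M (\<lambda>\<omega>. (norm (K \<omega>))\<^sup>2)"
proof (rule integrable_cong_AE_imp)
  show "integrable M (\<lambda>\<omega>. trace (K \<omega> ** K \<omega>))"
    using integrable_bounded_linear[OF bounded_linear_trace inv_sq_integrable] by (simp add: K_def)
  have "AE \<omega> in M. (norm (K \<omega>))\<^sup>2 = trace (K \<omega> ** K \<omega>)"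
    using Ahat_pos_def
    by eventually_elim (simp add: norm_symmetric_matrix_sq K_def matrix_inv_pos_def)
  then show "AE \<omega> in M. trace (K \<omega> ** K \<omega>) = (norm (K \<omega>))\<^sup>2"
    by eventually_elim simp
qed measurable

lemma K_integrable: "integrable M K"
proof (rule Bochner_Integration.integrable_bound)
  show "integrable M (\<lambda>\<omega>. 1 + (norm (K \<omega>))\<^sup>2)"
    using norm_K_sq_integrable by simp
  have "t \<le> 1 + t\<^sup>2" for t :: real
    using zero_le_power2[of "t - 1/2"] by (simp add: power2_eq_square algebra_simps)
  then show "AE \<omega> in M. norm (K \<omega>) \<le> norm (1 + (norm (K \<omega>))\<^sup>2)"
    by simp
qed measurable

lemma KAK_integrable: "integrable M (\<lambda>\<omega>. K \<omega> ** A ** K \<omega>)"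
proof -
  obtain c where c: "0 < c" "\<And>(P :: real^'n^'n) (Q :: real^'n^'n). norm (P ** Q) \<le> norm P * norm Q * c"
    using matrix_mult.pos_bounded by blast
  show ?thesis
  proof (rule Bochner_Integration.integrable_bound)
    show "integrable M (\<lambda>\<omega>. norm A * c * c * (norm (K \<omega>))\<^sup>2)"
      using norm_K_sq_integrable by simp
    have "norm (K \<omega> ** A ** K \<omega>) \<le> norm A * c * c * (norm (K \<omega>))\<^sup>2" for \<omega>
    proof -
      have "norm (K \<omega> ** A ** K \<omega>) \<le> norm (K \<omega> ** A) * norm (K \<omega>) * c" by (rule c(2))
      also have "\<dots> \<le> (norm (K \<omega>) * norm A * c) * norm (K \<omega>) * c"
        using c by (intro mult_right_mono) auto
      finally show ?thesis by (simp add: power2_eq_square mult_ac)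
    qed
    then show "AE \<omega> in M. norm (K \<omega> ** A ** K \<omega>) \<le> norm (norm A * c * c * (norm (K \<omega>))\<^sup>2)"
      using order_trans[OF _ abs_ge_self] by auto
  qed measurable
qed

lemma trace_K_integrable: "integrable M (\<lambda>\<omega>. trace (R ** K \<omega>))"
  and trace_KAK_integrable: "integrable M (\<lambda>\<omega>. trace (R ** (K \<omega> ** A ** K \<omega>)))"
  by (rule integrable_bounded_linear[OF trace_mult_bounded_linear K_integrable]
      integrable_bounded_linear[OF trace_mult_bounded_linear KAK_integrable])+

section \<open>Moments and their series\<close>

lemma AE_X: "AE \<omega> in M. pos_def (Ahat \<omega>) \<and> pos_def (X \<omega>) \<and> pos_def (mat 1 - X \<omega>)"
  using Ahat_pos_def Ahat_less by eventually_elim (auto intro: X_pos_def X_less_pos_def)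

lemma AE_trace_moment_pos: "AE \<omega> in M. 0 < trace (S ** mat_pow (X \<omega>) k)"
  using AE_X by eventually_elim (auto intro: trace_moment_pos[OF S])

lemma moment_sums: "moment sums (\<alpha> * K_mean)"
  and moment_Suc_sums: "(\<lambda>k. real (k + 1) * moment k) sums (\<alpha>\<^sup>2 * KAK_mean)"
proof -
  note facts = trace_moment_pos[OF S] trace_moment_sums[OF S]
  have "(\<lambda>k. \<integral>\<omega>. trace (S ** mat_pow (X \<omega>) k) \<partial>M) sums (\<integral>\<omega>. \<alpha> * trace (R ** K \<omega>) \<partial>M)"
  proof (rule sums_integral_nonneg)
    show "AE \<omega> in M. (\<forall>k. 0 \<le> trace (S ** mat_pow (X \<omega>) k)) \<and>
        (\<lambda>k. trace (S ** mat_pow (X \<omega>) k)) sums (\<alpha> * trace (R ** K \<omega>))"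
      using AE_X
      by eventually_elim (metis Y(1,2) facts(1,2) less_imp_le)
  qed (use moment_integrable trace_K_integrable in auto)
  then show "moment sums (\<alpha> * K_mean)"
    by (simp add: moment_def[abs_def] K_mean_def)
  have "(\<lambda>k. \<integral>\<omega>. real (k + 1) * trace (S ** mat_pow (X \<omega>) k) \<partial>M) sums
      (\<integral>\<omega>. \<alpha>\<^sup>2 * trace (R ** (K \<omega> ** A ** K \<omega>)) \<partial>M)"
  proof (rule sums_integral_nonneg)
    show "AE \<omega> in M. (\<forall>k. 0 \<le> real (k + 1) * trace (S ** mat_pow (X \<omega>) k)) \<and>
        (\<lambda>k. real (k + 1) * trace (S ** mat_pow (X \<omega>) k)) sums
          (\<alpha>\<^sup>2 * trace (R ** (K \<omega> ** A ** K \<omega>)))"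
      using AE_X
    proof eventually_elim
      case (elim \<omega>)
      then have "0 \<le> real (k + 1) * trace (S ** mat_pow (X \<omega>) k)" for k
        using facts(1)[of "X \<omega>" k] by (intro mult_nonneg_nonneg) auto
      moreover have "(\<lambda>k. real (k + 1) * trace (S ** mat_pow (X \<omega>) k)) sums
          (\<alpha>\<^sup>2 * trace (R ** (K \<omega> ** A ** K \<omega>)))"
        using elim facts(3)[OF _ _ Y(1)] Y(3) by simp
      ultimately show ?case by blast
    qed
  qed (use moment_integrable trace_KAK_integrable in auto)
  then show "(\<lambda>k. real (k + 1) * moment k) sums (\<alpha>\<^sup>2 * KAK_mean)"
    by (simp add: moment_def[abs_def] KAK_mean_def del: of_nat_add of_nat_Suc)
qed

lemma moment_pos: "0 < moment k"
proof -
  have nonneg: "AE \<omega> in M. 0 \<le> trace (S ** mat_pow (X \<omega>) k)"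
    using AE_trace_moment_pos by eventually_elim (rule less_imp_le)
  have "moment k \<noteq> 0"
  proof
    assume "moment k = 0"
    then have "AE \<omega> in M. trace (S ** mat_pow (X \<omega>) k) = 0"
      unfolding moment_def using integral_nonneg_eq_0_iff_AE[OF moment_integrable nonneg] by simp
    \<comment> \<open>A null integral would make the integrand both zero and positive almost surely,
      which a probability measure excludes.\<close>
    then have "AE \<omega> in M. False"
      using AE_trace_moment_pos[of k] by eventually_elim simp
    then show False by simp
  qed
  moreover have "0 \<le> moment k"
    unfolding moment_def by (rule integral_nonneg_AE[OF nonneg])
  ultimately show ?thesis by simp
qed

lemma moment_log_convex: "moment (k + 1) ^ 2 \<le> moment k * moment (k + 2)"
proof -
  \<comment> \<open>The minimizer of the nonnegative quadratic polynomial in \<open>t\<close> below.\<close>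
  define t where "t = moment (k + 1) / moment (k + 2)"
  have "AE \<omega> in M. 0 \<le> t\<^sup>2 * trace (S ** mat_pow (X \<omega>) (k + 2)) -
      2 * t * trace (S ** mat_pow (X \<omega>) (k + 1)) + trace (S ** mat_pow (X \<omega>) k)"
    using AE_X by eventually_elim (use trace_moment_quadratic[OF S] in blast)
  then have "0 \<le> (\<integral>\<omega>. t\<^sup>2 * trace (S ** mat_pow (X \<omega>) (k + 2)) - 2 * t * trace (S ** mat_pow (X \<omega>) (k + 1))
      + trace (S ** mat_pow (X \<omega>) k) \<partial>M)"
    by (rule integral_nonneg_AE)
  also have "\<dots> = t\<^sup>2 * moment (k + 2) - 2 * t * moment (k + 1) + moment k"
    using moment_integrable by (simp add: moment_def del: mat_pow.simps add_2_eq_Suc' add_Suc_right)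
  finally show ?thesis
    using moment_pos[of "k + 2"] by (simp add: t_def power2_eq_square field_simps)
qed

text \<open>\<open>X\<close> is affine in \<open>Ahat\<close>, so \<open>moment 1\<close> depends
  only on the mean of \<open>Ahat\<close>. The Loewner bound on the mean makes the subtracted trace
  at most \<open>trace S\<close>, which is \<open>moment 0\<close>.\<close>

lemma moment_initial: "(1 - inverse \<alpha>) * moment 0 \<le> moment 1"
proof -
  let ?E = "\<integral>\<omega>. Ahat \<omega> \<partial>M"
  let ?f = "\<lambda>P. trace (S ** (A_isqrt ** P ** A_isqrt))"
  have lin: "bounded_linear ?f"
    by (intro bounded_linear_compose[OF trace_mult_bounded_linear]
        bounded_linear_compose[OF matrix_mult.bounded_linear_left matrix_mult.bounded_linear_right])
  have "0 \<le> ?f (A - ?E)"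
    using mean_le
    by (intro trace_mult_pos_semidef S pos_semidef_congruence[OF A_isqrt(3)]) (simp add: loewner_le_def)
  then have le: "?f ?E \<le> trace S"
    by (simp add: matrix_mult.diff_left matrix_mult.diff_right trace_sub A_isqrt_A)
  have "moment 1 = (\<integral>\<omega>. trace S - inverse \<alpha> * ?f (Ahat \<omega>) \<partial>M)"
    by (simp add: moment_def X_def matrix_mult.diff_right matrix_mult.scaleR_right trace_sub trace_scaleR)
  also have "\<dots> = trace S - inverse \<alpha> * ?f ?E"
    using integrable_bounded_linear[OF lin Ahat_integrable] integral_bounded_linear[OF lin Ahat_integrable]
    by (simp add: prob_space)
  finally have "moment 1 = trace S - inverse \<alpha> * ?f ?E" .
  moreover have "moment 0 = trace S"
    by (simp add: moment_def prob_space)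
  moreover have "inverse \<alpha> * ?f ?E \<le> inverse \<alpha> * trace S"
    using le \<alpha>_pos by (intro mult_left_mono) auto
  ultimately show ?thesis
    by (simp add: left_diff_distrib)
qed

sublocale seq: log_convex_sequence moment "1 - inverse \<alpha>"
  using \<alpha> moment_pos moment_log_convex moment_initial
  by unfold_locales (auto simp: inverse_le_1_iff simp del: One_nat_def add_2_eq_Suc' add_Suc_right)

section \<open>The risk as a quadratic polynomial\<close>

lemma KAK_mean_pos: "0 < KAK_mean"
proof -
  \<comment> \<open>All terms are positive, so the single term \<open>moment 0\<close> bounds the
    sum of the series from below.\<close>
  have "(\<Sum>k<1. real (k + 1) * moment k) \<le> \<alpha>\<^sup>2 * KAK_mean"
    using moment_Suc_sums moment_pos
      sum_le_suminf[of "\<lambda>k. real (k + 1) * moment k" "{..<1}"]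
    by (auto simp: sums_iff less_imp_le)
  then have "0 < \<alpha>\<^sup>2 * KAK_mean"
    using moment_pos[of 0] by simp
  then show ?thesis by (simp add: zero_less_mult_iff)
qed

lemma K_mean_nonneg: "0 \<le> K_mean"
proof -
  have "0 \<le> \<alpha> * K_mean"
    using moment_sums moment_pos by (metis less_imp_le sums_iff suminf_nonneg)
  then show ?thesis using \<alpha>_pos by (simp add: zero_le_mult_iff)
qed

text \<open>Expanding the error, each mixed term contains \<open>A\<close> next to its inverse and
  collapses to \<open>K\<close>.\<close>

lemma est_error_scaled:
  "est_error M A A R (\<lambda>\<omega>. c *\<^sub>R K \<omega>) =
     c\<^sup>2 * KAK_mean - 2 * c * K_mean + trace (R ** matrix_inv A)"
proof -
  let ?T = "matrix_inv A"
  have A_inv: "A ** ?T = mat 1" "?T ** A = mat 1" "transpose ?T = ?T"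
    using matrix_inv_pos_def[OF A] by auto
  have "est_error M A A R (\<lambda>\<omega>. c *\<^sub>R K \<omega>) = (\<integral>\<omega>. c\<^sup>2 * trace (R ** (K \<omega> ** A ** K \<omega>))
      - 2 * c * trace (R ** K \<omega>) + trace (R ** ?T) \<partial>M)"
    unfolding est_error_def
  \<comment> \<open>Symmetry of \<open>K\<close> holds only almost surely, so the integrand is
    rewritten almost everywhere, at the price of checking measurability of both sides.\<close>
  proof (rule integral_cong_AE)
    have [measurable]: "(\<lambda>\<omega>. transpose (c *\<^sub>R K \<omega> - ?T)) \<in> borel_measurable M"
      unfolding transpose_def by (intro borel_measurable_vec_lambda) measurable
    show "(\<lambda>\<omega>. weighted_norm_sq A R (c *\<^sub>R K \<omega> - ?T)) \<in> borel_measurable M"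
      unfolding weighted_norm_sq_def by measurable
    show "AE \<omega> in M. weighted_norm_sq A R (c *\<^sub>R K \<omega> - ?T) =
        c\<^sup>2 * trace (R ** (K \<omega> ** A ** K \<omega>)) - 2 * c * trace (R ** K \<omega>) + trace (R ** ?T)"
      using Ahat_pos_def
    proof eventually_elim
      case (elim \<omega>)
      define E where "E = c *\<^sub>R K \<omega> - ?T"
      have "transpose E = E"
        using matrix_inv_pos_def(3)[OF elim] A_inv(3)
        by (simp add: E_def transpose_diff transpose_scalar K_def)
      then have "weighted_norm_sq A R E = trace (mat_sqrt R ** (E ** A ** E) ** mat_sqrt R)"
        by (simp add: weighted_norm_sq_def matrix_mul_assoc)
      also have "\<dots> = trace (R ** (E ** A ** E))"
        by (rule trace_mat_sqrt_conj[OF R(1)])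
      also have "E ** A ** E = c\<^sup>2 *\<^sub>R (K \<omega> ** A ** K \<omega>) - (2 * c) *\<^sub>R K \<omega> + ?T"
        by (simp add: E_def matrix_mult.diff_left matrix_mult.diff_right matrix_mult.scaleR_left
            matrix_mult.scaleR_right matrix_mul_assoc[of _ A ?T, symmetric] A_inv power2_eq_square)
           (simp add: scaleR_2 scaleR_diff_right flip: scaleR_scaleR)
      finally have "weighted_norm_sq A R (c *\<^sub>R K \<omega> - ?T) =
          trace (R ** (c\<^sup>2 *\<^sub>R (K \<omega> ** A ** K \<omega>) - (2 * c) *\<^sub>R K \<omega> + ?T))"
        by (simp only: E_def)
      then show ?case
        by (simp add: matrix_mult.diff_right matrix_mult.add_right matrix_mult.scaleR_right
            trace_add trace_sub trace_scaleR)
    qed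
  qed measurable
  also have "\<dots> = c\<^sup>2 * KAK_mean - 2 * c * K_mean + trace (R ** ?T)"
    using trace_K_integrable trace_KAK_integrable
    by (simp add: KAK_mean_def K_mean_def prob_space)
  finally show ?thesis .
qed

definition b_star :: real where "b_star = 1 - K_mean / KAK_mean"

text \<open>Completing the square: the risk depends only on the distance to \<open>b_star\<close>,
  which yields both the unique minimizer and the monotone chain of errors.\<close>

lemma est_error_eq:
  "est_error M A A R (\<lambda>\<omega>. (1 - b) *\<^sub>R K \<omega>) =
     KAK_mean * (b - b_star)\<^sup>2 + (trace (R ** matrix_inv A) - K_mean\<^sup>2 / KAK_mean)"
  unfolding est_error_scaled b_star_def using KAK_mean_pos
  by (simp add: power2_eq_square field_simps)

lemma est_error_mono:
  assumes "b \<le> b'" "b' \<le> b_star"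
  shows "est_error M A A R (\<lambda>\<omega>. (1 - b') *\<^sub>R K \<omega>) \<le> est_error M A A R (\<lambda>\<omega>. (1 - b) *\<^sub>R K \<omega>)"
proof -
  have "(b_star - b')\<^sup>2 \<le> (b_star - b)\<^sup>2"
    using assms by (intro power_mono) auto
  then show ?thesis
    unfolding est_error_eq using KAK_mean_pos by (simp add: power2_commute mult_left_mono)
qed

lemma is_arg_min_risk_iff:
  "is_arg_min (\<lambda>b. est_error M A A R (\<lambda>\<omega>. K \<omega> - b *\<^sub>R K \<omega>)) (\<lambda>_. True) b \<longleftrightarrow> b = b_star"
proof -
  have eq: "est_error M A A R (\<lambda>\<omega>. K \<omega> - b *\<^sub>R K \<omega>) =
      KAK_mean * (b - b_star)\<^sup>2 + (trace (R ** matrix_inv A) - K_mean\<^sup>2 / KAK_mean)" for b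
    using est_error_eq[of b] by (simp add: scaleR_diff_left)
  have "is_arg_min (\<lambda>b. est_error M A A R (\<lambda>\<omega>. K \<omega> - b *\<^sub>R K \<omega>)) (\<lambda>_. True) b \<longleftrightarrow>
      (\<forall>y. (b - b_star)\<^sup>2 \<le> (y - b_star)\<^sup>2)"
    unfolding is_arg_min_linorder eq using KAK_mean_pos by simp
  also have "\<dots> \<longleftrightarrow> b = b_star"
    by (metis diff_self power2_eq_iff_nonneg order_refl power2_less_eq_zero_iff power_zero_numeral
        right_minus_eq zero_le_power2)
  finally show ?thesis .
qed

section \<open>The coefficient sequence and its limit\<close>

definition b_seq :: "nat \<Rightarrow> real" where
  "b_seq N = (\<Sum>k=0..N. weight \<alpha> N k * moment k) / (\<Sum>k=0..N. weight_star N k * moment k)"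

lemma b_seq_eq: "b_seq N = 1 - seq.C N / seq.D N"
  using seq.D_pos[of N] unfolding b_seq_def seq.sum_weight_star seq.sum_weight[OF refl]
  by (simp add: diff_divide_distrib)

lemma b_seq_incseq: "incseq b_seq"
  using seq.decseq_C_div_D unfolding b_seq_eq[abs_def] by (simp add: mono_def decseq_def)

lemma b_seq_nonneg: "0 \<le> b_seq N"
  using seq.C_le_D[of N] seq.D_pos[of N] by (simp add: b_seq_eq divide_le_eq)

lemma b_seq_tendsto: "b_seq \<longlonglongrightarrow> b_star"
proof -
  have "(\<lambda>N. 1 - seq.C N / seq.D N) \<longlonglongrightarrow>
      1 - \<alpha> * K_mean / ((1 - (1 - inverse \<alpha>)) * (\<alpha>\<^sup>2 * KAK_mean))"
    by (intro tendsto_intros seq.tendsto_C_div_D moment_sums moment_Suc_sums)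
  \<comment> \<open>The factor 1 - \<eta> equals 1/\<alpha>, so all powers of \<alpha>
    cancel.\<close>
  moreover have "1 - \<alpha> * K_mean / ((1 - (1 - inverse \<alpha>)) * (\<alpha>\<^sup>2 * KAK_mean)) = b_star"
    using \<alpha>_pos KAK_mean_pos by (simp add: b_star_def power2_eq_square divide_simps)
  ultimately show ?thesis
    by (simp add: b_seq_eq[abs_def])
qed

lemma b_seq_le_b_star: "b_seq N \<le> b_star"
  by (rule incseq_le[OF b_seq_incseq b_seq_tendsto])

lemma b_star_le_1: "b_star \<le> 1"
  using K_mean_nonneg KAK_mean_pos by (simp add: b_star_def)

section \<open>The moments as expected quadratic forms\<close>

lemma A_sqrt_pow: "mat_pow (A_sqrt ** P ** A_isqrt) k = A_sqrt ** mat_pow P k ** A_isqrt"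
  by (induction k) (simp_all add: A_isqrt matrix_mul_assoc A_isqrt_cancel)

lemma mat_pow_scaleR: "mat_pow (c *\<^sub>R P) k = c ^ k *\<^sub>R mat_pow P k"
  by (induction k) (simp_all add: matrix_mult.scaleR_left matrix_mult.scaleR_right)

text \<open>Conjugation by \<open>A_sqrt\<close> carries \<open>X\<close> to -1/\<alpha> times (Ahat
  - \<alpha> A) A^(-1), and powers respect this similarity. Multiplying by the inverse of
  \<open>A\<close> on the left turns the leading \<open>A_sqrt\<close> into
  \<open>A_isqrt\<close>.\<close>

lemma inv_A_pow_eq:
  "(inverse \<alpha> ^ k * (-1) ^ k) *\<^sub>R (matrix_inv A ** mat_pow ((Ahat \<omega> - \<alpha> *\<^sub>R A) ** matrix_inv A) k) =
     A_isqrt ** mat_pow (X \<omega>) k ** A_isqrt"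
proof -
  have "A_sqrt ** X \<omega> ** A_isqrt = (- inverse \<alpha>) *\<^sub>R ((Ahat \<omega> - \<alpha> *\<^sub>R A) ** matrix_inv A)"
    by (simp add: X_eq A_isqrt_sq matrix_mult.scaleR_left matrix_mult.scaleR_right
        matrix_mult.minus_left matrix_mult.minus_right matrix_mul_assoc A_isqrt)
  then have "A_sqrt ** mat_pow (X \<omega>) k ** A_isqrt =
      (inverse \<alpha> ^ k * (-1) ^ k) *\<^sub>R mat_pow ((Ahat \<omega> - \<alpha> *\<^sub>R A) ** matrix_inv A) k"
    by (metis A_sqrt_pow mat_pow_scaleR mult_minus1_right power_mult_distrib)
  then have "matrix_inv A ** (A_sqrt ** mat_pow (X \<omega>) k ** A_isqrt) =
      (inverse \<alpha> ^ k * (-1) ^ k) *\<^sub>R (matrix_inv A ** mat_pow ((Ahat \<omega> - \<alpha> *\<^sub>R A) ** matrix_inv A) k)"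
    by (simp only: matrix_mult.scaleR_right)
  moreover have "matrix_inv A ** (A_sqrt ** mat_pow (X \<omega>) k ** A_isqrt) =
      A_isqrt ** mat_pow (X \<omega>) k ** A_isqrt"
    by (simp add: A_isqrt_sq matrix_mul_assoc A_isqrt_cancel)
  ultimately show ?thesis by simp
qed

text \<open>Independence replaces the outer product by its mean \<open>R\<close>, and
  \<open>trace_S\<close> moves the inverse roots into \<open>S\<close>. The coefficients
  \<open>w\<close> stay arbitrary to serve numerator and denominator alike.\<close>

lemma moment_quadratic_form:
  fixes q :: "'w \<Rightarrow> real^'n"
  assumes q: "q \<in> borel_measurable M" and indep: "indep_rv M Ahat q"
    and outer: "integrable M (\<lambda>\<omega>. outer_product (q \<omega>))" "(\<integral>\<omega>. outer_product (q \<omega>) \<partial>M) = R"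
  shows "(\<integral>\<omega>. (\<Sum>k=0..N. w k * inverse \<alpha> ^ k * (-1) ^ k *
      (q \<omega> \<bullet> ((matrix_inv A ** mat_pow ((Ahat \<omega> - \<alpha> *\<^sub>R A) ** matrix_inv A) k) *v q \<omega>))) \<partial>M) =
    (\<Sum>k=0..N. w k * moment k)"
proof -
  \<comment> \<open>Written as a function of a matrix value \<open>P\<close>, because independence
    is given for \<open>Ahat\<close> and must be passed through a Borel function of it.\<close>
  define h where "h k P = A_isqrt ** mat_pow (mat 1 - inverse \<alpha> *\<^sub>R (A_isqrt ** P ** A_isqrt)) k ** A_isqrt"
    for k and P :: "real^'n^'n"
  have h: "h k (Ahat \<omega>) = A_isqrt ** mat_pow (X \<omega>) k ** A_isqrt" for k \<omega>
    by (simp add: h_def X_def)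
  have lin: "bounded_linear (\<lambda>P. A_isqrt ** P ** A_isqrt)"
    by (intro bounded_linear_compose[OF matrix_mult.bounded_linear_left matrix_mult.bounded_linear_right])
  have meas: "h k \<in> borel_measurable borel" for k
    unfolding h_def by measurable
  have int: "integrable M (\<lambda>\<omega>. h k (Ahat \<omega>))" for k
    unfolding h by (rule integrable_bounded_linear[OF lin mat_pow_X_integrable])
  note quad = indep_quadratic_form[OF Ahat_measurable q indep meas int outer(1), unfolded outer(2)]
  have moment: "(\<integral>\<omega>. q \<omega> \<bullet> (h k (Ahat \<omega>) *v q \<omega>) \<partial>M) = moment k" for k
  proof -
    have "trace (R ** (\<integral>\<omega>. h k (Ahat \<omega>) \<partial>M)) = (\<integral>\<omega>. trace (R ** h k (Ahat \<omega>)) \<partial>M)"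
      by (rule integral_bounded_linear[OF trace_mult_bounded_linear int, symmetric])
    then show ?thesis
      unfolding quad(1) moment_def trace_S h[symmetric] .
  qed
  have summand: "w k * inverse \<alpha> ^ k * (-1) ^ k *
      (q \<omega> \<bullet> ((matrix_inv A ** mat_pow ((Ahat \<omega> - \<alpha> *\<^sub>R A) ** matrix_inv A) k) *v q \<omega>)) =
      w k * (q \<omega> \<bullet> (h k (Ahat \<omega>) *v q \<omega>))" for k \<omega>
    unfolding h inv_A_pow_eq[symmetric] by (simp add: scaleR_matrix_vector_assoc[symmetric])
  show ?thesis
    unfolding summand by (simp add: moment quad(2))
qed

end

theorem theorem10p2:
  fixes M :: "'w measure"
    and A R :: "real^'n^'n"
    and Ahat :: "'w \<Rightarrow> real^'n^'n"
    and \<alpha> :: real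
  defines "Khat \<equiv> \<lambda>\<omega>. matrix_inv (Ahat \<omega>)"
    and "Ais \<equiv> matrix_inv (mat_sqrt A)"
    and "Zhat \<equiv> \<lambda>\<omega>. Ahat \<omega> - \<alpha> *\<^sub>R A"
  defines "Xhat \<equiv> \<lambda>\<omega>. inverse \<alpha> *\<^sub>R (- (Ais ** Zhat \<omega> ** Ais))"
    and "S \<equiv> Ais ** R ** Ais"
  defines "risk \<equiv> \<lambda>\<beta>::real. est_error M A A R (\<lambda>\<omega>. Khat \<omega> - \<beta> *\<^sub>R Khat \<omega>)"
  defines "\<beta>_star \<equiv> arg_min risk (\<lambda>_. True)"
    and "\<beta> \<equiv> \<lambda>N. (\<Sum>k=0..N. weight \<alpha> N k * trace_mean M S (\<lambda>\<omega>. mat_pow (Xhat \<omega>) k)) /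
                    (\<Sum>k=0..N. weight_star N k * trace_mean M S (\<lambda>\<omega>. mat_pow (Xhat \<omega>) k))"
  assumes "prob_space M"
    and "pos_def A"
    and "Ahat \<in> borel_measurable M"
    and "AE \<omega> in M. pos_def (Ahat \<omega>)"
    and "(\<integral>\<omega>. Ahat \<omega> \<partial>M) \<preceq>\<^sub>L A"
    and "integrable M (\<lambda>\<omega>. matrix_inv (Ahat \<omega>) ** matrix_inv (Ahat \<omega>))"
    and "\<alpha> \<ge> 1"
    and "AE \<omega> in M. 0 \<prec>\<^sub>L Ahat \<omega> \<and> Ahat \<omega> \<prec>\<^sub>L \<alpha> *\<^sub>R A"
    and "pos_semidef R" and "R \<noteq> 0"
  shows "(\<forall>\<omega>. Xhat \<omega> = mat 1 - inverse \<alpha> *\<^sub>R (Ais ** Ahat \<omega> ** Ais)) \<and>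
    (\<exists>!b. is_arg_min risk (\<lambda>_. True) b) \<and>
    (\<forall>qhat :: 'w \<Rightarrow> real^'n.
       qhat \<in> borel_measurable M \<and> indep_rv M Ahat qhat \<and>
       integrable M (\<lambda>\<omega>. outer_product (qhat \<omega>)) \<and>
       (\<integral>\<omega>. outer_product (qhat \<omega>) \<partial>M) = R \<longrightarrow>
       (\<forall>N\<ge>1. \<beta> N =
          (\<integral>\<omega>. (\<Sum>k=0..N. weight \<alpha> N k * inverse \<alpha> ^ k * (-1) ^ k *
             (qhat \<omega> \<bullet> ((matrix_inv A ** mat_pow (Zhat \<omega> ** matrix_inv A) k) *v qhat \<omega>))) \<partial>M) /
          (\<integral>\<omega>. (\<Sum>k=0..N. weight_star N k * inverse \<alpha> ^ k * (-1) ^ k *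
             (qhat \<omega> \<bullet> ((matrix_inv A ** mat_pow (Zhat \<omega> ** matrix_inv A) k) *v qhat \<omega>))) \<partial>M))) \<and>
    \<beta> \<longlonglongrightarrow> \<beta>_star \<and>
    0 \<le> \<beta> 1 \<and>
    (\<forall>N\<ge>1. \<beta> N \<le> \<beta> (N + 1)) \<and>
    (\<forall>N\<ge>1. \<beta> N \<le> \<beta>_star) \<and>
    \<beta>_star \<le> 1 \<and>
    est_error M A A R Khat \<ge> est_error M A A R (\<lambda>\<omega>. (1 - \<beta> 1) *\<^sub>R Khat \<omega>) \<and>
    (\<forall>N\<ge>1. est_error M A A R (\<lambda>\<omega>. (1 - \<beta> N) *\<^sub>R Khat \<omega>) \<ge>
            est_error M A A R (\<lambda>\<omega>. (1 - \<beta> (N + 1)) *\<^sub>R Khat \<omega>)) \<and>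
    (\<forall>N\<ge>1. est_error M A A R (\<lambda>\<omega>. (1 - \<beta> N) *\<^sub>R Khat \<omega>) \<ge>
            est_error M A A R (\<lambda>\<omega>. (1 - \<beta>_star) *\<^sub>R Khat \<omega>))"
proof -
  interpret est: random_matrix_estimator M A R Ahat \<alpha>
    using assms(9-18) unfolding random_matrix_estimator_def random_matrix_estimator_axioms_def by auto
  have Khat: "Khat = est.K"
    by (simp add: Khat_def est.K_def fun_eq_iff)
  have Ais: "Ais = est.A_isqrt"
    by (simp add: Ais_def est.A_isqrt_def)
  have X_alt: "Xhat \<omega> = mat 1 - inverse \<alpha> *\<^sub>R (Ais ** Ahat \<omega> ** Ais)" for \<omega>
    using est.X_eq[of \<omega>] by (simp add: Xhat_def Zhat_def Ais est.X_def)
  then have Xhat: "Xhat = est.X"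
    by (simp add: est.X_def Ais fun_eq_iff)
  have S: "S = est.S"
    by (simp add: S_def est.S_def Ais)
  have \<beta>: "\<beta> = est.b_seq"
    unfolding \<beta>_def est.b_seq_def trace_mean_def est.moment_def S Xhat
      trace_mat_sqrt_conj[OF est.S(1)] ..
  have risk: "is_arg_min risk (\<lambda>_. True) b \<longleftrightarrow> b = est.b_star" for b
    unfolding risk_def Khat by (rule est.is_arg_min_risk_iff)
  \<comment> \<open>\<open>arg_min\<close> chooses some minimizer; once the predicate singles out
    one real, the choice is forced.\<close>
  then have "is_arg_min risk (\<lambda>_. True) = (\<lambda>b. b = est.b_star)"
    by blast
  then have \<beta>_star: "\<beta>_star = est.b_star"
    by (simp add: \<beta>_star_def arg_min_def)
  \<comment> \<open>The unshrunk estimator is the coefficient 0, so the first link of the chain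
    rests on the nonnegativity of the first coefficient.\<close>
  have "est_error M A A R est.K \<ge> est_error M A A R (\<lambda>\<omega>. (1 - est.b_seq 1) *\<^sub>R est.K \<omega>)"
    using est.est_error_mono[of 0 "est.b_seq 1"] est.b_seq_nonneg est.b_seq_le_b_star by simp
  then show ?thesis
    unfolding Khat \<beta> \<beta>_star risk Zhat_def
    using X_alt est.b_seq_tendsto est.b_seq_nonneg[of 1] est.b_seq_le_b_star est.b_star_le_1
      est.est_error_mono incseq_SucD[OF est.b_seq_incseq]
    by (simp add: est.moment_quadratic_form est.b_seq_def[symmetric])
qed

end
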